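(* Let $p\ge0$ and $\psi_p(s)=|s|^p$ on $[-1,1]$. (i) If $p=2m$ with $m\ge1$ an integer, then $\Lambda_{\psi_{2m}}=\{2,4,\ldots,2m\}$. (ii) If $p>0$ and $p$ is not an even integer, then $\Lambda_{\psi_p}=\{2,4,6,\ldots\}$ (all positive even integers). (iii) If $p=0$, then $\Lambda_{\psi_0}=\emptyset$.
   Context: Fix an integer $d\ge 2$. $\sigma$ is the normalized rotation-invariant Borel probability measure on the unit sphere $\mathbb S^{d-1}\subset\mathbb R^d$. $\mathcal H_\ell$ denotes the space of restrictions to $\mathbb S^{d-1}$ of real homogeneous harmonic polynomials of degree $\ell$ on $\mathbb R^d$. For $\psi\in C([-1,1])$, the Funk--Hecke multiplier $\lambda_\ell(\psi)$ is the scalar such that $\int_{\mathbb S^{d-1}}\psi(\langle u,v\rangle)Y(v)\,d\sigma(v)=\lambda_\ell(\psi)Y(u)$ for all $Y\in\mathcal H_\ell$, $u\in\mathbb S^{d-1}$. The active spectrum is $\Lambda_\psi:=\{\ell\ge1:\lambda_\ell(\psi)\ne0\}$. $|s|^0$ is understood as the constant $1$. *)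

theory Defs
  imports "HOL-Analysis.Analysis" "HOL-Probability.Probability"
begin

text \<open>The ambient space is \<open>real ^ 'n\<close>, so the dimension \<open>d\<close> is \<open>CARD('n)\<close>.\<close>

definition rotation :: "(real ^ 'n \<Rightarrow> real ^ 'n) \<Rightarrow> bool" where
  "rotation T \<longleftrightarrow> orthogonal_transformation T \<and> det (matrix T) = 1"

text \<open>For \<open>CARD('n) \<ge> 2\<close> there is exactly one measure with this property. The condition on
  \<open>sets\<close> makes the unit sphere itself (not the whole space) the underlying space.\<close>

definition rotation_invariant_prob_on_sphere :: "(real ^ 'n) measure \<Rightarrow> bool" where
  "rotation_invariant_prob_on_sphere \<sigma> \<longleftrightarrow>
     prob_space \<sigma> \<and>
     sets \<sigma> = sets (restrict_space borel (sphere 0 1)) \<and>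
     (\<forall>T. rotation T \<longrightarrow> distr \<sigma> \<sigma> T = \<sigma>)"

text \<open>Polynomials are represented by their polynomial functions. The sum runs over the finitely
  many multi-indices \<open>\<alpha>\<close> of total degree \<open>l\<close>; the zero polynomial is homogeneous of every degree.\<close>

definition homogeneous_polynomial :: "nat \<Rightarrow> (real ^ 'n \<Rightarrow> real) \<Rightarrow> bool" where
  "homogeneous_polynomial l P \<longleftrightarrow>
     (\<exists>c :: ('n \<Rightarrow> nat) \<Rightarrow> real. \<forall>x.
        P x = (\<Sum>\<alpha> | (\<Sum>i\<in>UNIV. \<alpha> i) = l. c \<alpha> * (\<Prod>i\<in>UNIV. (x $ i) ^ \<alpha> i)))"

definition partial_derivative :: "'n \<Rightarrow> (real ^ 'n \<Rightarrow> real) \<Rightarrow> real ^ 'n \<Rightarrow> real" where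
  "partial_derivative i f x = deriv (\<lambda>t. f (x + t *\<^sub>R axis i 1)) 0"

definition laplacian :: "(real ^ 'n \<Rightarrow> real) \<Rightarrow> real ^ 'n \<Rightarrow> real" where
  "laplacian f x = (\<Sum>i\<in>UNIV. partial_derivative i (partial_derivative i f) x)"

definition spherical_harmonics :: "nat \<Rightarrow> (real ^ 'n \<Rightarrow> real) set" where
  "spherical_harmonics l =
     {restrict P (sphere 0 1) | P. homogeneous_polynomial l P \<and> (\<forall>x. laplacian P x = 0)}"

text \<open>A kernel \<open>\<psi> \<in> C([-1,1])\<close> is represented by a function on all reals; only its values on
  \<open>[-1,1]\<close> enter. The scalar below exists and is unique, by the Funk--Hecke theorem and because
  \<open>spherical_harmonics l\<close> contains a nonzero function when \<open>CARD('n) \<ge> 2\<close>.\<close>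

definition funk_hecke_multiplier ::
    "(real ^ 'n) measure \<Rightarrow> nat \<Rightarrow> (real \<Rightarrow> real) \<Rightarrow> real" where
  "funk_hecke_multiplier \<sigma> l \<psi> =
     (THE c. \<forall>Y \<in> spherical_harmonics l. \<forall>u \<in> sphere 0 1.
        (\<integral>v. \<psi> (u \<bullet> v) * Y v \<partial>\<sigma>) = c * Y u)"

definition active_spectrum :: "(real ^ 'n) measure \<Rightarrow> (real \<Rightarrow> real) \<Rightarrow> nat set" where
  "active_spectrum \<sigma> \<psi> = {l. l \<ge> 1 \<and> funk_hecke_multiplier \<sigma> l \<psi> \<noteq> 0}"

text \<open>The case distinction is needed because \<open>0 powr 0 = 0\<close>, whereas \<open>\<bar>s\<bar>\<^sup>0\<close> is to be
  the constant 1.\<close>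

definition abs_power :: "real \<Rightarrow> real \<Rightarrow> real" where
  "abs_power p s = (if p = 0 then 1 else \<bar>s\<bar> powr p)"

end

theory Submission
  imports Defs "HOL-Real_Asymp.Real_Asymp"
begin

text \<open>Let \<open>F\<^sub>p(u) = \<integral>\<bar>u \<bullet> v\<bar>\<^sup>p P(v) d\<sigma>(v)\<close> for a harmonic \<open>P\<close>, homogeneous of degree \<open>l\<close>.
  Invariance under the rotations of the coordinate planes yields a divergence theorem on the sphere,
  and hence \<open>(p + 2) (p + 1) F\<^sub>p = (p + 2 - l) (p + l + d) F\<^sub>p\<^sub>+\<^sub>2\<close>. Divide by the same identity
  for \<open>P = 1\<close> and iterate: the normalised weights \<open>\<bar>u \<bullet> v\<bar>\<^sup>q\<close> concentrate at \<open>u\<close> and \<open>- u\<close> as \<open>q\<close>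
  grows, so the normalised \<open>F\<^sub>q(u)\<close> tend to \<open>(P(u) + P(- u)) / 2\<close>. This expresses \<open>F\<^sub>p(u)\<close> as \<open>P(u)\<close>
  times a convergent infinite product for even \<open>l\<close> (and as 0 for odd \<open>l\<close>), which vanishes exactly
  if \<open>l = p + 2 k + 2\<close> for some natural \<open>k\<close>.\<close>

subsection \<open>Homogeneous and harmonic polynomials\<close>

text \<open>Every entry of a multi-index is at most its total degree. Finiteness has to be known
  because sums over infinite sets are 0 by convention.\<close>

lemma finite_multi_indices: "finite {\<alpha> :: 'n::finite \<Rightarrow> nat. (\<Sum>i\<in>UNIV. \<alpha> i) = l}"
proof (rule finite_subset)
  show "{\<alpha> :: 'n \<Rightarrow> nat. (\<Sum>i\<in>UNIV. \<alpha> i) = l} \<subseteq> PiE UNIV (\<lambda>_. {..l})"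
    by (auto intro: member_le_sum)
qed (simp add: finite_PiE)

lemma homogeneous_polynomial_monomial:
  fixes \<alpha> :: "'n::finite \<Rightarrow> nat"
  assumes "(\<Sum>i\<in>UNIV. \<alpha> i) = l"
  shows "homogeneous_polynomial l (\<lambda>x :: real ^ 'n. \<Prod>i\<in>UNIV. (x $ i) ^ \<alpha> i)"
  unfolding homogeneous_polynomial_def
proof (intro exI allI)
  fix x :: "real ^ 'n"
  show "(\<Prod>i\<in>UNIV. (x $ i) ^ \<alpha> i) = (\<Sum>\<beta> | (\<Sum>i\<in>UNIV. \<beta> i) = l.
      (if \<beta> = \<alpha> then 1 else 0) * (\<Prod>i\<in>UNIV. (x $ i) ^ \<beta> i))"
    using assms by (simp add: if_distrib[of "\<lambda>c. c * _"] sum.delta finite_multi_indices cong: if_cong)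
qed

lemma homogeneous_polynomial_add:
  assumes "homogeneous_polynomial l P" "homogeneous_polynomial l Q"
  shows "homogeneous_polynomial l (\<lambda>x. P x + Q x)"
proof -
  obtain c where c: "\<forall>x. P x = (\<Sum>\<alpha> | (\<Sum>i\<in>UNIV. \<alpha> i) = l. c \<alpha> * (\<Prod>i\<in>UNIV. (x $ i) ^ \<alpha> i))"
    using assms(1) unfolding homogeneous_polynomial_def by blast
  obtain d where d: "\<forall>x. Q x = (\<Sum>\<alpha> | (\<Sum>i\<in>UNIV. \<alpha> i) = l. d \<alpha> * (\<Prod>i\<in>UNIV. (x $ i) ^ \<alpha> i))"
    using assms(2) unfolding homogeneous_polynomial_def by blast
  show ?thesis unfolding homogeneous_polynomial_def
    by (rule exI[of _ "\<lambda>\<alpha>. c \<alpha> + d \<alpha>"]) (simp add: c d sum.distrib algebra_simps)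
qed

lemma homogeneous_polynomial_cmult:
  assumes "homogeneous_polynomial l P"
  shows "homogeneous_polynomial l (\<lambda>x. a * P x)"
proof -
  obtain c where c: "\<forall>x. P x = (\<Sum>\<alpha> | (\<Sum>i\<in>UNIV. \<alpha> i) = l. c \<alpha> * (\<Prod>i\<in>UNIV. (x $ i) ^ \<alpha> i))"
    using assms(1) unfolding homogeneous_polynomial_def by blast
  show ?thesis unfolding homogeneous_polynomial_def
    by (rule exI[of _ "\<lambda>\<alpha>. a * c \<alpha>"]) (simp add: c sum_distrib_left algebra_simps)
qed

lemma homogeneous_polynomial_sum:
  assumes "finite A" "\<And>a. a \<in> A \<Longrightarrow> homogeneous_polynomial l (P a)"
  shows "homogeneous_polynomial l (\<lambda>x. \<Sum>a\<in>A. P a x)"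
  using assms
proof (induction A rule: finite_induct)
  case empty
  show ?case unfolding homogeneous_polynomial_def by (rule exI[of _ "\<lambda>_. 0"]) simp
next
  case (insert a A)
  then show ?case by (simp add: homogeneous_polynomial_add)
qed

lemma homogeneous_polynomial_coord_mult:
  fixes P :: "real ^ 'n \<Rightarrow> real"
  assumes "homogeneous_polynomial l P"
  shows "homogeneous_polynomial (Suc l) (\<lambda>x. x $ k * P x)"
proof -
  obtain c where c: "\<And>x. P x = (\<Sum>\<alpha> | (\<Sum>i\<in>UNIV. \<alpha> i) = l. c \<alpha> * (\<Prod>i\<in>UNIV. (x $ i) ^ \<alpha> i))"
    using assms(1) unfolding homogeneous_polynomial_def by blast
  have up: "x $ k * (\<Prod>i\<in>UNIV. (x $ i) ^ \<alpha> i) = (\<Prod>i\<in>UNIV. (x $ i) ^ (\<alpha>(k := Suc (\<alpha> k))) i)"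
    for x :: "real ^ 'n" and \<alpha>
    by (subst (1 2) prod.remove[of UNIV k]) auto
  have eq: "(\<lambda>x. x $ k * P x) = (\<lambda>x. \<Sum>\<alpha> | (\<Sum>i\<in>UNIV. \<alpha> i) = l. 
      c \<alpha> * (\<Prod>i\<in>UNIV. (x $ i) ^ (\<alpha>(k := Suc (\<alpha> k))) i))"
    by (simp add: c sum_distrib_left mult.left_commute[of "_ $ k"] up del: fun_upd_apply)
  show ?thesis unfolding eq
  proof (intro homogeneous_polynomial_sum finite_multi_indices homogeneous_polynomial_cmult
        homogeneous_polynomial_monomial)
    fix \<alpha> :: "'n \<Rightarrow> nat"
    assume "\<alpha> \<in> {\<alpha>. (\<Sum>i\<in>UNIV. \<alpha> i) = l}"
    then show "(\<Sum>i\<in>UNIV. (\<alpha>(k := Suc (\<alpha> k))) i) = Suc l"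
      by (subst sum.remove[of UNIV k]) (auto simp: sum.remove[of UNIV k \<alpha>])
  qed
qed

lemma homogeneous_polynomial_one: "homogeneous_polynomial 0 (\<lambda>_ :: real ^ 'n. 1)"
  using homogeneous_polynomial_monomial[of "\<lambda>_ :: 'n. 0" 0] by simp

text \<open>With z = x_i + i x_j, the identity Re (w z^(l+1)) = x_i Re (w z^l) + x_j Re (i w z^l)
  raises the degree by one. It changes the coefficient, so the induction runs over all complex
  \<open>w\<close>.\<close>

lemma homogeneous_polynomial_Re_power:
  fixes i j :: "'n::finite"
  shows "homogeneous_polynomial l (\<lambda>x :: real ^ 'n. Re (w * Complex (x $ i) (x $ j) ^ l))"
proof (induction l arbitrary: w)
  case 0
  show ?case using homogeneous_polynomial_cmult[OF homogeneous_polynomial_one, of "Re w"] by simp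
next
  case (Suc l)
  have eq: "(\<lambda>x :: real ^ 'n. Re (w * Complex (x $ i) (x $ j) ^ Suc l)) =
    (\<lambda>x. x $ i * Re (w * Complex (x $ i) (x $ j) ^ l) + x $ j * Re ((\<i> * w) * Complex (x $ i) (x $ j) ^ l))"
    by (rule ext) (simp add: algebra_simps)
  show ?case unfolding eq
    by (intro homogeneous_polynomial_add homogeneous_polynomial_coord_mult Suc)
qed

section \<open>Derivatives of polynomials and Euler's relation\<close>

text \<open>The truncated subtraction in \<open>\<alpha> k - 1\<close> is harmless: where
  \<open>\<alpha> k = 0\<close>, the factor \<open>real (\<alpha> k)\<close> removes the
  summand.\<close>

lemma has_derivative_monomial:
  fixes \<alpha> :: "'n::finite \<Rightarrow> nat" and x :: "real ^ 'n"
  shows "((\<lambda>x. \<Prod>i\<in>UNIV. (x $ i) ^ \<alpha> i) has_derivative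
    (\<lambda>h. \<Sum>k\<in>UNIV. h $ k * (real (\<alpha> k) * (\<Prod>i\<in>UNIV. (x $ i) ^ (\<alpha>(k := \<alpha> k - 1)) i)))) (at x)"
proof -
  have "((\<lambda>x. (x $ i) ^ \<alpha> i) has_derivative (\<lambda>h. real (\<alpha> i) * (h $ i) * (x $ i) ^ (\<alpha> i - 1))) (at x)"
    for i
    by (auto intro!: derivative_eq_intros bounded_linear.has_derivative[OF bounded_linear_vec_nth]
        simp: algebra_simps)
  then have "((\<lambda>x. \<Prod>i\<in>UNIV. (x $ i) ^ \<alpha> i) has_derivative
    (\<lambda>h. \<Sum>k\<in>UNIV. (real (\<alpha> k) * (h $ k) * (x $ k) ^ (\<alpha> k - 1)) * (\<Prod>i\<in>UNIV - {k}. (x $ i) ^ \<alpha> i))) (at x)"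
    by (intro has_derivative_prod)
  moreover have "(x $ k) ^ (\<alpha> k - 1) * (\<Prod>i\<in>UNIV - {k}. (x $ i) ^ \<alpha> i) =
      (\<Prod>i\<in>UNIV. (x $ i) ^ (\<alpha>(k := \<alpha> k - 1)) i)" for k
    by (subst prod.remove[of UNIV k "\<lambda>i. (x $ i) ^ (\<alpha>(k := \<alpha> k - 1)) i"]) auto
  ultimately show ?thesis
    by (simp add: algebra_simps del: fun_upd_apply)
qed

text \<open>Multiplying by \<open>x $ k\<close> restores the lowered exponent, so each summand is
  \<open>\<alpha> k\<close> times the monomial.\<close>

lemma monomial_euler:
  fixes \<alpha> :: "'n::finite \<Rightarrow> nat" and x :: "real ^ 'n"
  shows "(\<Sum>k\<in>UNIV. x $ k * (real (\<alpha> k) * (\<Prod>i\<in>UNIV. (x $ i) ^ (\<alpha>(k := \<alpha> k - 1)) i))) =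
    real (\<Sum>k\<in>UNIV. \<alpha> k) * (\<Prod>i\<in>UNIV. (x $ i) ^ \<alpha> i)"
proof -
  have eq: "x $ k * (real (\<alpha> k) * (\<Prod>i\<in>UNIV. (x $ i) ^ (\<alpha>(k := \<alpha> k - 1)) i)) =
    real (\<alpha> k) * (\<Prod>i\<in>UNIV. (x $ i) ^ \<alpha> i)" for k
    by (subst (1 2) prod.remove[of UNIV k]) (auto simp: power_eq_if)
  show ?thesis by (simp only: eq of_nat_sum sum_distrib_right)
qed

text \<open>\<open>D k\<close> and \<open>H k x\<close> are the k-th partial derivative and its differential at x. In degree 0
  all \<open>D k\<close> vanish, so \<open>real l - 1\<close> is harmless there.\<close>

lemma homogeneous_polynomial_derivatives:
  fixes P :: "real ^ 'n \<Rightarrow> real"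
  assumes "homogeneous_polynomial l P"
  obtains D :: "'n \<Rightarrow> real ^ 'n \<Rightarrow> real" and H :: "'n \<Rightarrow> real ^ 'n \<Rightarrow> real ^ 'n \<Rightarrow> real"
  where "\<And>x. (P has_derivative (\<lambda>h. \<Sum>k\<in>UNIV. h $ k * D k x)) (at x)"
    and "\<And>x. (\<Sum>k\<in>UNIV. x $ k * D k x) = real l * P x"
    and "\<And>k x. (D k has_derivative H k x) (at x)"
    and "\<And>k x. H k x x = (real l - 1) * D k x"
    and "\<And>k h. continuous_on UNIV (\<lambda>x. H k x h)"
proof -
  define A where "A = {\<alpha> :: 'n \<Rightarrow> nat. (\<Sum>i\<in>UNIV. \<alpha> i) = l}"
  obtain c where c: "\<And>x. P x = (\<Sum>\<alpha>\<in>A. c \<alpha> * (\<Prod>i\<in>UNIV. (x $ i) ^ \<alpha> i))"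
    using assms(1) unfolding homogeneous_polynomial_def A_def by blast
  define m :: "('n \<Rightarrow> nat) \<Rightarrow> real ^ 'n \<Rightarrow> real" where "m \<alpha> x = (\<Prod>i\<in>UNIV. (x $ i) ^ \<alpha> i)" for \<alpha> x
  define s :: "('n \<Rightarrow> nat) \<Rightarrow> 'n \<Rightarrow> 'n \<Rightarrow> nat" where "s \<alpha> k = \<alpha>(k := \<alpha> k - 1)" for \<alpha> k
  define D where "D k x = (\<Sum>\<alpha>\<in>A. c \<alpha> * (real (\<alpha> k) * m (s \<alpha> k) x))" for k x
  define H where "H k x h = (\<Sum>\<alpha>\<in>A. c \<alpha> * (real (\<alpha> k) *
    (\<Sum>j\<in>UNIV. h $ j * (real (s \<alpha> k j) * m (s (s \<alpha> k) j) x))))" for k x h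
  have der: "(m \<alpha> has_derivative (\<lambda>h. \<Sum>k\<in>UNIV. h $ k * (real (\<alpha> k) * m (s \<alpha> k) x))) (at x)" for \<alpha> x
    unfolding m_def[abs_def] s_def by (rule has_derivative_monomial)
  have eul: "(\<Sum>k\<in>UNIV. x $ k * (real (\<alpha> k) * m (s \<alpha> k) x)) = real (\<Sum>k\<in>UNIV. \<alpha> k) * m \<alpha> x" for \<alpha> x
    unfolding m_def[abs_def] s_def by (rule monomial_euler)
  have P: "P = (\<lambda>x. \<Sum>\<alpha>\<in>A. c \<alpha> * m \<alpha> x)" by (rule ext) (simp add: c m_def)
  have cont: "continuous_on UNIV (m \<alpha>)" for \<alpha>
    unfolding m_def[abs_def] by (intro continuous_intros)
  show thesis
  proof
    fix x
    have "(P has_derivative (\<lambda>h. \<Sum>\<alpha>\<in>A. c \<alpha> * (\<Sum>k\<in>UNIV. h $ k * (real (\<alpha> k) * m (s \<alpha> k) x)))) (at x)"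
      unfolding P by (intro has_derivative_sum has_derivative_mult_right der)
    moreover have "(\<Sum>\<alpha>\<in>A. c \<alpha> * (\<Sum>k\<in>UNIV. h $ k * (real (\<alpha> k) * m (s \<alpha> k) x))) =
      (\<Sum>k\<in>UNIV. h $ k * D k x)" for h
      unfolding D_def sum_distrib_left by (subst sum.swap) (simp add: algebra_simps)
    ultimately show "(P has_derivative (\<lambda>h. \<Sum>k\<in>UNIV. h $ k * D k x)) (at x)" by simp
  next
    fix x
    have "(\<Sum>k\<in>UNIV. x $ k * D k x) = (\<Sum>\<alpha>\<in>A. c \<alpha> * (\<Sum>k\<in>UNIV. x $ k * (real (\<alpha> k) * m (s \<alpha> k) x)))"
      unfolding D_def sum_distrib_left by (subst sum.swap) (simp add: algebra_simps)
    also have "\<dots> = real l * P x"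
      unfolding eul P sum_distrib_left by (rule sum.cong) (auto simp: A_def algebra_simps simp flip: of_nat_sum)
    finally show "(\<Sum>k\<in>UNIV. x $ k * D k x) = real l * P x" .
  next
    fix k x
    show "(D k has_derivative H k x) (at x)"
      unfolding D_def[abs_def] H_def[abs_def] by (intro has_derivative_sum has_derivative_mult_right der)
  next
    fix k x
    \<comment> \<open>Lowering a positive k-th exponent leaves total degree l - 1. If
      \<open>\<alpha> k = 0\<close>, the factor \<open>real (\<alpha> k)\<close> makes both sides 0,
      also for l = 0.\<close>
    have "real (\<alpha> k) * real (\<Sum>j\<in>UNIV. s \<alpha> k j) = real (\<alpha> k) * (real l - 1)" if "\<alpha> \<in> A" for \<alpha>
    proof (cases "\<alpha> k")
      case (Suc n)
      have "(\<Sum>j\<in>UNIV. \<alpha> j) = \<alpha> k + (\<Sum>j\<in>UNIV - {k}. \<alpha> j)" by (rule sum.remove) auto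
      moreover have "(\<Sum>j\<in>UNIV. s \<alpha> k j) = (\<alpha> k - 1) + (\<Sum>j\<in>UNIV - {k}. \<alpha> j)"
        by (subst sum.remove[of _ k]) (auto simp: s_def)
      ultimately have "Suc (\<Sum>j\<in>UNIV. s \<alpha> k j) = l" using that Suc by (simp add: A_def)
      then have "real l = real (\<Sum>j\<in>UNIV. s \<alpha> k j) + 1" by (simp del: of_nat_sum flip: of_nat_Suc)
      then show ?thesis by simp
    qed simp
    then have "(\<Sum>\<alpha>\<in>A. c \<alpha> * (real (\<alpha> k) * (real (\<Sum>j\<in>UNIV. s \<alpha> k j) * m (s \<alpha> k) x)))
      = (\<Sum>\<alpha>\<in>A. c \<alpha> * (real (\<alpha> k) * (real l - 1) * m (s \<alpha> k) x))"
      by (intro sum.cong refl) (simp only: mult.assoc[symmetric])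
    then show "H k x x = (real l - 1) * D k x"
      unfolding H_def eul D_def sum_distrib_left by (simp add: algebra_simps)
  next
    fix k h
    show "continuous_on UNIV (\<lambda>x. H k x h)"
      unfolding H_def by (intro continuous_intros cont)
  qed
qed

section \<open>The Laplacian and a nonzero harmonic in every degree\<close>

text \<open>Connects the one-variable \<open>deriv\<close> of the definition with Frechet
  derivatives, by the chain rule along a line in direction \<open>axis i 1\<close>.\<close>

lemma partial_derivative_has_derivative:
  assumes "(f has_derivative f') (at x)"
  shows "partial_derivative i f x = f' (axis i 1)"
proof -
  have "((\<lambda>t. f (x + t *\<^sub>R axis i 1)) has_derivative (\<lambda>t. f' (t *\<^sub>R axis i 1))) (at 0)"
    by (rule has_derivative_compose[of "\<lambda>t. x + t *\<^sub>R axis i 1" "\<lambda>t. t *\<^sub>R axis i 1"])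
      (use assms in \<open>auto intro!: derivative_eq_intros\<close>)
  moreover have "(\<lambda>t. f' (t *\<^sub>R axis i 1)) = (*) (f' (axis i 1))"
    using has_derivative_bounded_linear[OF assms] by (simp add: linear_simps fun_eq_iff)
  ultimately show ?thesis
    unfolding partial_derivative_def by (intro DERIV_imp_deriv) (simp add: has_field_derivative_def)
qed

lemma laplacian_has_derivative:
  fixes f :: "real ^ 'n \<Rightarrow> real"
  assumes "\<And>x. (f has_derivative (\<lambda>h. \<Sum>k\<in>UNIV. h $ k * D k x)) (at x)"
    and "\<And>k x. (D k has_derivative H k x) (at x)"
  shows "laplacian f x = (\<Sum>k\<in>UNIV. H k x (axis k 1))"
proof -
  have "partial_derivative k f = D k" for k
    by (rule ext) (simp add: partial_derivative_has_derivative[OF assms(1)] axis_def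
        if_distrib[of "\<lambda>c. c * _"] cong: if_cong)
  then show ?thesis
    by (simp add: laplacian_def partial_derivative_has_derivative[OF assms(2)])
qed

text \<open>A power of the linear map z = x_i + i x_j is differentiated twice along each axis e_k.
  Each summand carries the factor z(e_k)^2, and these factors add up to 1 + i^2 = 0.\<close>

lemma laplacian_Re_power:
  fixes i j :: "'n::finite"
  assumes "i \<noteq> j"
  shows "laplacian (\<lambda>x :: real ^ 'n. Re (Complex (x $ i) (x $ j) ^ l)) x = 0"
proof -
  define z :: "real ^ 'n \<Rightarrow> complex" where "z x = Complex (x $ i) (x $ j)" for x
  have z: "z = (\<lambda>x. of_real (x $ i) + \<i> * of_real (x $ j))"
    by (simp add: z_def fun_eq_iff complex_eq_iff)
  have blz: "bounded_linear z" unfolding z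
    by (intro bounded_linear_add bounded_linear_const_mult bounded_linear_compose[OF bounded_linear_of_real]
       bounded_linear_vec_nth)
  have der: "((\<lambda>x. Re (w * z x ^ n)) has_derivative (\<lambda>h. Re (w * (of_nat n * z h * z x ^ (n - 1))))) (at x)" for w n x
    by (auto intro!: derivative_eq_intros bounded_linear.has_derivative[OF blz] simp: algebra_simps)
  have pd: "partial_derivative k (\<lambda>x. Re (w * z x ^ n)) =
      (\<lambda>x. Re ((w * of_nat n * z (axis k 1)) * z x ^ (n - 1)))" for k w n
    by (rule ext, subst partial_derivative_has_derivative[OF der]) (simp add: algebra_simps)
  have sq: "(\<Sum>k\<in>UNIV. z (axis k 1) * z (axis k 1)) = 0"
  proof -
    have "(\<Sum>k\<in>UNIV. z (axis k 1) * z (axis k 1)) =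
      (\<Sum>k\<in>UNIV. (if k = i then 1 else 0) - (if k = j then 1 else 0 :: complex))"
      by (intro sum.cong) (use assms in \<open>auto simp: z axis_def algebra_simps\<close>)
    also have "\<dots> = 0" by (simp add: sum_subtractf)
    finally show ?thesis .
  qed
  have "laplacian (\<lambda>x. Re (1 * z x ^ l)) x = 
    (\<Sum>k\<in>UNIV. Re (((z (axis k 1) * z (axis k 1)) * (of_nat l * of_nat (l - 1) * z x ^ (l - 1 - 1)))))"
    unfolding laplacian_def pd by (simp add: algebra_simps)
  also have "\<dots> = 0"
    unfolding Re_sum[symmetric] sum_distrib_right[symmetric] sq by simp
  finally show ?thesis by (simp add: z_def)
qed

text \<open>The real part of (x_i + i x_j)^l is 1 at the i-th axis vector. A nonzero value is what
  makes the scalar in \<open>funk_hecke_multiplier\<close> unique.\<close>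

lemma ex_nonzero_spherical_harmonic:
  assumes "CARD('n) \<ge> 2"
  obtains Y and u :: "real ^ 'n" where "Y \<in> spherical_harmonics l" "u \<in> sphere 0 1" "Y u \<noteq> 0"
proof -
  obtain i j :: 'n where ij: "i \<noteq> j"
    using assms by (metis card_2_iff' ex_card UNIV_I)
  define P :: "real ^ 'n \<Rightarrow> real" where "P x = Re (Complex (x $ i) (x $ j) ^ l)" for x
  have "homogeneous_polynomial l P"
    using homogeneous_polynomial_Re_power[of l 1 i j] by (simp add: P_def[abs_def])
  moreover have "laplacian P x = 0" for x
    unfolding P_def[abs_def] by (rule laplacian_Re_power[OF ij])
  ultimately have "restrict P (sphere 0 1) \<in> spherical_harmonics l"
    unfolding spherical_harmonics_def by blast
  moreover have "P (axis i 1) = 1"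
    using ij by (simp add: P_def axis_def flip: one_complex.code)
  ultimately show thesis
    by (intro that[of "restrict P (sphere 0 1)" "axis i 1"]) auto
qed

subsection \<open>Integration against a rotation-invariant measure\<close>

lemma space_rotation_invariant:
  assumes "rotation_invariant_prob_on_sphere \<sigma>"
  shows "space \<sigma> = sphere 0 1"
proof -
  have "sets \<sigma> = sets (restrict_space borel (sphere 0 1))"
    using assms by (simp add: rotation_invariant_prob_on_sphere_def)
  from sets_eq_imp_space_eq[OF this] show ?thesis by (simp add: space_restrict_space)
qed

lemma measurable_continuous_on_sphere:
  fixes f :: "real ^ 'n \<Rightarrow> 'b::topological_space"
  assumes "rotation_invariant_prob_on_sphere \<sigma>" "continuous_on (sphere 0 1) f"
  shows "f \<in> borel_measurable \<sigma>"
proof -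
  have "sets \<sigma> = sets (restrict_space borel (sphere 0 1))"
    using assms by (simp add: rotation_invariant_prob_on_sphere_def)
  from measurable_cong_sets[OF this refl] show ?thesis
    using borel_measurable_continuous_on_restrict[OF assms(2)] by blast
qed

lemma integrable_continuous_on_sphere:
  fixes f :: "real ^ 'n \<Rightarrow> real"
  assumes "rotation_invariant_prob_on_sphere \<sigma>" "continuous_on (sphere 0 1) f"
  shows "integrable \<sigma> f"
proof -
  interpret prob_space \<sigma> using assms by (simp add: rotation_invariant_prob_on_sphere_def)
  have "bounded (f ` sphere 0 1)"
    by (intro compact_imp_bounded compact_continuous_image assms compact_sphere)
  then obtain B where "\<forall>y\<in>f ` sphere 0 1. norm y \<le> B"
    unfolding bounded_iff by (rule exE)
  then have "\<And>x. x \<in> sphere 0 1 \<Longrightarrow> norm (f x) \<le> B"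
    by (rule bspec[OF _ imageI])
  then show ?thesis
    by (intro integrable_const_bound[of _ B] measurable_continuous_on_sphere[OF assms] AE_I2)
      (simp add: space_rotation_invariant[OF assms(1)])
qed

lemma rotation_sphere_iff:
  assumes "rotation T"
  shows "T v \<in> sphere 0 1 \<longleftrightarrow> v \<in> sphere 0 1"
  using assms by (simp add: rotation_def orthogonal_transformation)

lemma integral_rotation:
  fixes f :: "real ^ 'n \<Rightarrow> real"
  assumes \<sigma>: "rotation_invariant_prob_on_sphere \<sigma>" and T: "rotation T"
    and f: "continuous_on (sphere 0 1) f"
  shows "(\<integral>v. f (T v) \<partial>\<sigma>) = (\<integral>v. f v \<partial>\<sigma>)"
proof -
  have "linear T" using T by (simp add: rotation_def orthogonal_transformation_def)
  then have "T \<in> measurable borel borel"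
    by (intro borel_measurable_continuous_onI linear_continuous_on linear_conv_bounded_linear[THEN iffD1])
  then have "T \<in> measurable (restrict_space borel (sphere 0 1)) (restrict_space borel (sphere 0 1))"
    by (rule measurable_restrict_space3) (use rotation_sphere_iff[OF T] in auto)
  moreover have "sets \<sigma> = sets (restrict_space borel (sphere 0 1))"
    using \<sigma> by (simp add: rotation_invariant_prob_on_sphere_def)
  ultimately have "T \<in> measurable \<sigma> \<sigma>" by (simp cong: measurable_cong_sets)
  from integral_distr[OF this measurable_continuous_on_sphere[OF \<sigma> f]]
  show ?thesis using \<sigma> T by (simp add: rotation_invariant_prob_on_sphere_def)
qed

section \<open>Rotations of a coordinate plane\<close>

text \<open>For \<open>i \<noteq> j\<close> this is the rotation by the angle \<open>t\<close> in
  the (i, j) plane, written as the identity plus corrections along two axes so that linearity and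
  the derivative in \<open>t\<close> are direct.\<close>

definition plane_rotation :: "'n \<Rightarrow> 'n \<Rightarrow> real \<Rightarrow> real ^ 'n \<Rightarrow> real ^ 'n" where
  "plane_rotation i j t v = v + ((cos t - 1) * v $ i - sin t * v $ j) *\<^sub>R axis i 1
     + (sin t * v $ i + (cos t - 1) * v $ j) *\<^sub>R axis j 1"

lemma plane_rotation_nth:
  assumes "i \<noteq> j"
  shows "plane_rotation i j t v $ k =
    (if k = i then cos t * v $ i - sin t * v $ j else if k = j then sin t * v $ i + cos t * v $ j else v $ k)"
  using assms by (auto simp: plane_rotation_def axis_def algebra_simps)

lemma plane_rotation_zero: "plane_rotation i j 0 v = v"
  by (simp add: plane_rotation_def)

lemma orthogonal_plane_rotation:
  assumes "i \<noteq> j"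
  shows "orthogonal_transformation (plane_rotation i j t)"
  unfolding orthogonal_transformation_def
proof (intro conjI allI)
  show "linear (plane_rotation i j t)"
    by (intro linearI) (simp_all add: plane_rotation_def algebra_simps)
next
  fix v w
  let ?R = "plane_rotation i j t"
  have exp: "(v + a *\<^sub>R axis i 1 + b *\<^sub>R axis j 1) \<bullet> (w + c *\<^sub>R axis i 1 + d *\<^sub>R axis j 1) =
    v \<bullet> w + c * v $ i + d * v $ j + a * w $ i + b * w $ j + a * c + b * d" for a b c d
  proof -
    have "axis i (1::real) $ j = 0" "axis j (1::real) $ i = 0"
      using assms by (simp_all add: axis_def)
    then show ?thesis
      by (simp add: inner_axis inner_axis' inner_add_left inner_add_right algebra_simps)
  qed
  \<comment> \<open>The corrections collect into a multiple of sin^2 + cos^2 - 1. The Pythagorean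
    simp rules are switched off until this factor is exposed.\<close>
  have "?R v \<bullet> ?R w = v \<bullet> w + ((sin t)\<^sup>2 + (cos t)\<^sup>2 - 1) * (v $ i * w $ i + v $ j * w $ j)"
    unfolding plane_rotation_def exp by (simp add: algebra_simps power2_eq_square del: sin_cos_squared_add sin_cos_squared_add2 sin_cos_squared_add3)
  then show "?R v \<bullet> ?R w = v \<bullet> w" by simp
qed

lemma plane_rotation_add:
  assumes "i \<noteq> j"
  shows "plane_rotation i j (s + t) = plane_rotation i j s \<circ> plane_rotation i j t"
  using assms[symmetric]
  by (simp add: fun_eq_iff vec_eq_iff plane_rotation_nth[OF assms] cos_add sin_add algebra_simps)

text \<open>The determinant is a square because the rotation by t is the square of the rotation by t/2.\<close>

lemma rotation_plane_rotation:
  fixes i j :: "'n::finite"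
  assumes "i \<noteq> j"
  shows "rotation (plane_rotation i j t)"
proof -
  let ?R = "plane_rotation i j (t / 2)"
  have o: "orthogonal_transformation ?R" by (rule orthogonal_plane_rotation[OF assms])
  have "det (matrix (plane_rotation i j t)) = det (matrix (?R \<circ> ?R))"
    using plane_rotation_add[OF assms, of "t/2" "t/2"] by simp
  also have "\<dots> = det (matrix ?R) * det (matrix ?R)"
    using o by (simp add: matrix_compose orthogonal_transformation_linear det_mul)
  also have "\<dots> = 1"
    using det_orthogonal_matrix[of "matrix ?R"] o orthogonal_transformation_matrix[of ?R] by auto
  finally show ?thesis
    by (simp add: rotation_def orthogonal_plane_rotation[OF assms])
qed

text \<open>The velocity is the infinitesimal rotation x_i e_j - x_j e_i at the current point x of
  the orbit.\<close>

lemma plane_rotation_has_vector_derivative: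
  assumes "i \<noteq> j"
  shows "((\<lambda>t. plane_rotation i j t v) has_vector_derivative
    (plane_rotation i j t v $ i *\<^sub>R axis j 1 - plane_rotation i j t v $ j *\<^sub>R axis i 1)) (at t)"
proof -
  have 1: "plane_rotation i j t v $ i = cos t * v $ i - sin t * v $ j"
    "plane_rotation i j t v $ j = sin t * v $ i + cos t * v $ j"
    using assms by (auto simp: plane_rotation_nth)
  show ?thesis unfolding 1 unfolding plane_rotation_def
    by (auto intro!: derivative_eq_intros simp: has_vector_derivative_def fun_eq_iff algebra_simps)
qed

section \<open>Integration by parts on the sphere\<close>

text \<open>By invariance the integral of \<open>g\<close> composed with the rotation by t does not
  depend on t. Differentiating at t = 0 under the integral, by dominated convergence, gives the
  claim.\<close>

lemma integral_angular_derivative_zero: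
  fixes g :: "real ^ 'n \<Rightarrow> real"
  assumes \<sigma>: "rotation_invariant_prob_on_sphere \<sigma>"
    and g: "\<And>x. (g has_derivative g' x) (at x)"
    and g': "\<And>h. continuous_on UNIV (\<lambda>x. g' x h)"
  shows "(\<integral>v. v $ i * g' v (axis j 1) - v $ j * g' v (axis i 1) \<partial>\<sigma>) = 0"
proof (cases "i = j")
  case False
  define L where "L v = v $ i * g' v (axis j 1) - v $ j * g' v (axis i 1)" for v
  have Lcont: "continuous_on UNIV L"
    unfolding L_def by (intro continuous_intros g')
  have gcont: "continuous_on S g" for S
    using g by (meson has_derivative_continuous continuous_at_imp_continuous_on)
  let ?R = "plane_rotation i j"
  have rot: "rotation (?R t)" for t by (rule rotation_plane_rotation[OF False])
  have der: "((\<lambda>t. g (?R t v)) has_real_derivative L (?R t v)) (at t)" for t v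
  proof -
    let ?w = "?R t v $ i *\<^sub>R axis j 1 - ?R t v $ j *\<^sub>R axis i 1"
    have bl: "bounded_linear (g' (?R t v))" by (rule has_derivative_bounded_linear[OF g])
    have "((\<lambda>t. g (?R t v)) has_derivative (\<lambda>s. g' (?R t v) (s *\<^sub>R ?w))) (at t)"
      using plane_rotation_has_vector_derivative[OF False, of v t]
      unfolding has_vector_derivative_def by (rule has_derivative_compose[OF _ g])
    then have "((\<lambda>t. g (?R t v)) has_vector_derivative g' (?R t v) ?w) (at t)"
      by (simp add: has_vector_derivative_def linear_cmul[OF bounded_linear.linear[OF bl]])
    also have "g' (?R t v) (?R t v $ i *\<^sub>R axis j 1 - ?R t v $ j *\<^sub>R axis i 1) = L (?R t v)"
      using bl by (simp add: L_def linear_simps)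
    finally show ?thesis by (simp add: has_real_derivative_iff_has_vector_derivative)
  qed
  define h where "h n = 1 / real (Suc n)" for n
  have h0: "h n > 0" for n by (simp add: h_def)
  have hlim: "h \<longlonglongrightarrow> 0" unfolding h_def by (rule LIMSEQ_Suc[OF lim_1_over_n])
  define q where "q n v = (g (?R (h n) v) - g v) / h n" for n v
  obtain B where B: "\<And>x. x \<in> sphere 0 1 \<Longrightarrow> norm (L x) \<le> B"
  proof -
    have "bounded (L ` sphere 0 1)"
      by (intro compact_imp_bounded compact_continuous_image continuous_on_subset[OF Lcont] compact_sphere) simp
    then obtain B where "\<forall>y\<in>L ` sphere 0 1. norm y \<le> B"
      unfolding bounded_iff by (rule exE)
    then show thesis by (intro that[of B]) (rule bspec[OF _ imageI])
  qed
  have q0: "(\<integral>v. q n v \<partial>\<sigma>) = 0" for n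
  proof -
    have "linear (?R (h n))" using rot by (simp add: rotation_def orthogonal_transformation_def)
    then have "continuous_on (sphere 0 1) (?R (h n))"
      by (intro linear_continuous_on linear_conv_bounded_linear[THEN iffD1])
    then have "continuous_on (sphere 0 1) (\<lambda>v. g (?R (h n) v))"
      by (rule continuous_on_compose2[OF gcont[of UNIV]]) simp
    then have "integrable \<sigma> (\<lambda>v. g (?R (h n) v))" "integrable \<sigma> g"
      using integrable_continuous_on_sphere[OF \<sigma>] gcont by auto
    then show ?thesis
      unfolding q_def using integral_rotation[OF \<sigma> rot gcont] by simp
  qed
  have "(\<lambda>n. \<integral>v. q n v \<partial>\<sigma>) \<longlonglongrightarrow> (\<integral>v. L v \<partial>\<sigma>)"
  proof (rule integral_dominated_convergence[where w="\<lambda>_. B"])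
    show "L \<in> borel_measurable \<sigma>"
      by (intro measurable_continuous_on_sphere[OF \<sigma>] continuous_on_subset[OF Lcont]) simp
    show "q n \<in> borel_measurable \<sigma>" for n
    proof -
      have "linear (?R (h n))" using rot by (simp add: rotation_def orthogonal_transformation_def)
      then have "continuous_on (sphere 0 1) (?R (h n))"
        by (intro linear_continuous_on linear_conv_bounded_linear[THEN iffD1])
      then have "continuous_on (sphere 0 1) (\<lambda>v. g (?R (h n) v))"
        by (rule continuous_on_compose2[OF gcont[of UNIV]]) simp
      then show ?thesis unfolding q_def
        using h0[of n] by (intro measurable_continuous_on_sphere[OF \<sigma>] continuous_intros gcont) auto
    qed
    show "integrable \<sigma> (\<lambda>_. B)"
      by (rule integrable_continuous_on_sphere[OF \<sigma>]) simp
    show "AE v in \<sigma>. (\<lambda>n. q n v) \<longlonglongrightarrow> L v"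
    proof (rule AE_I2)
      fix v
      have "((\<lambda>t. (g (?R t v) - g (?R 0 v)) / t) \<longlongrightarrow> L (?R 0 v)) (at 0)"
        using der[of v 0] by (simp add: has_field_derivative_iff)
      moreover have "filterlim h (at 0) sequentially"
        using h0 by (intro filterlim_atI hlim always_eventually allI) (simp add: less_imp_neq[symmetric])
      ultimately have "(\<lambda>n. (g (?R (h n) v) - g (?R 0 v)) / h n) \<longlonglongrightarrow> L (?R 0 v)"
        by (rule filterlim_compose)
      then show "(\<lambda>n. q n v) \<longlonglongrightarrow> L v"
        unfolding q_def plane_rotation_zero .
    qed
    fix n
    show "AE v in \<sigma>. norm (q n v) \<le> B"
    proof (rule AE_I2)
      fix v assume "v \<in> space \<sigma>"
      then have v: "v \<in> sphere 0 1" by (simp add: space_rotation_invariant[OF \<sigma>])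
      \<comment> \<open>The mean value theorem turns the difference quotient into a value of
        \<open>L\<close> at a rotated point. That point is still on the sphere, so the bound
        \<open>B\<close> dominates every \<open>q n\<close>.\<close>
      obtain t where "g (?R (h n) v) - g (?R 0 v) = (h n - 0) * L (?R t v)"
        using MVT2[of 0 "h n" "\<lambda>t. g (?R t v)" "\<lambda>t. L (?R t v)"] h0 der by blast
      then have "q n v = L (?R t v)" using h0[of n] by (simp add: q_def plane_rotation_zero)
      then show "norm (q n v) \<le> B" using B rotation_sphere_iff[OF rot] v by simp
    qed
  qed
  then have "(\<integral>v. L v \<partial>\<sigma>) = 0" unfolding q0 by (simp add: LIMSEQ_const_iff)
  then show ?thesis by (simp add: L_def)
qed simp

text \<open>Gauss' theorem for homogeneous vector fields: \<open>X\<close> is homogeneous of degree \<open>\<kappa>\<close>, by Euler's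
  relation. It comes from integrating the angular derivatives of \<open>x\<^sub>i X\<^sub>j\<close>.\<close>

lemma integral_divergence_sphere:
  fixes X :: "'n \<Rightarrow> real ^ 'n \<Rightarrow> real"
  assumes \<sigma>: "rotation_invariant_prob_on_sphere \<sigma>"
    and X: "\<And>j x. (X j has_derivative D j x) (at x)"
    and D: "\<And>j h. continuous_on UNIV (\<lambda>x. D j x h)"
    and hom: "\<And>j x. D j x x = \<kappa> * X j x"
  shows "(\<integral>v. (\<Sum>j\<in>UNIV. D j v (axis j 1)) \<partial>\<sigma>) =
    (real CARD('n) - 1 + \<kappa>) * (\<integral>v. (\<Sum>j\<in>UNIV. v $ j * X j v) \<partial>\<sigma>)"
proof -
  define g' :: "'n \<Rightarrow> 'n \<Rightarrow> real ^ 'n \<Rightarrow> real ^ 'n \<Rightarrow> real"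
    where "g' i j x h = h $ i * X j x + x $ i * D j x h" for i j x h
  have Xc: "continuous_on S (X j)" for S j
    using X by (meson has_derivative_continuous continuous_at_imp_continuous_on)
  have Dc: "continuous_on S (\<lambda>x. D j x h)" for S j h
    by (rule continuous_on_subset[OF D]) simp
  have g'c: "continuous_on S (\<lambda>x. g' i j x h)" for i j h S
    unfolding g'_def by (intro continuous_intros Xc Dc)
  have der: "((\<lambda>x. x $ i * X j x) has_derivative g' i j x) (at x)" for i j x
    unfolding g'_def by (auto intro!: derivative_eq_intros X bounded_linear.has_derivative[OF bounded_linear_vec_nth]
        simp: fun_eq_iff algebra_simps)
  define L where "L i j v = v $ i * g' i j v (axis j 1) - v $ j * g' i j v (axis i 1)" for i j v
  have L0: "(\<integral>v. L i j v \<partial>\<sigma>) = 0" for i j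
    unfolding L_def by (rule integral_angular_derivative_zero[OF \<sigma> der]) (rule g'c)
  have Lint: "integrable \<sigma> (L i j)" for i j
    unfolding L_def by (intro integrable_continuous_on_sphere[OF \<sigma>] continuous_intros g'c)
  \<comment> \<open>The sum over i turns v_i^2 into 1, and D_j v v into \<kappa> X_j by homogeneity.
    The diagonal i = j returns one of the \<open>CARD('n)\<close> subtracted copies of v_j X_j,
    whence the d - 1.\<close>
  have sum_L: "(\<Sum>i\<in>UNIV. \<Sum>j\<in>UNIV. L i j v) =
    (\<Sum>j\<in>UNIV. D j v (axis j 1)) - (real CARD('n) - 1 + \<kappa>) * (\<Sum>j\<in>UNIV. v $ j * X j v)"
    if "v \<in> sphere 0 1" for v
  proof -
    have "v \<bullet> v = 1" using that by (simp add: dot_square_norm)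
    then have n: "(\<Sum>i\<in>UNIV. v $ i * v $ i) = 1" by (simp add: inner_vec_def)
    have a: "v $ j * D j v v = (\<Sum>i\<in>UNIV. v $ j * (v $ i * D j v (axis i 1)))" for j
    proof -
      have l: "linear (D j v)" by (rule has_derivative_linear[OF X])
      have "D j v v = D j v (\<Sum>i\<in>UNIV. v $ i *\<^sub>R axis i 1)"
        by (simp add: basis_expansion flip: scalar_mult_eq_scaleR)
      also have "\<dots> = (\<Sum>i\<in>UNIV. v $ i * D j v (axis i 1))"
        by (simp add: linear_sum[OF l] linear_cmul[OF l])
      finally show ?thesis by (simp add: sum_distrib_left)
    qed
    have L: "L i j v = (if i = j then v $ j * X j v else 0) + (v $ i * v $ i) * D j v (axis j 1)
       - v $ j * X j v - v $ j * (v $ i * D j v (axis i 1))" for i j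
      by (simp add: L_def g'_def axis_def algebra_simps)
    have "(\<Sum>i\<in>UNIV. \<Sum>j\<in>UNIV. L i j v) = (\<Sum>j\<in>UNIV. \<Sum>i\<in>UNIV. L i j v)"
      by (rule sum.swap)
    also have "\<dots> = (\<Sum>j\<in>UNIV. v $ j * X j v + D j v (axis j 1)
       - real CARD('n) * (v $ j * X j v) - v $ j * D j v v)"
      unfolding L sum_subtractf sum.distrib sum_distrib_right[symmetric] n a by (simp add: mult.assoc)
    also have "\<dots> = (\<Sum>j\<in>UNIV. D j v (axis j 1) - (real CARD('n) - 1 + \<kappa>) * (v $ j * X j v))"
      by (rule sum.cong) (auto simp: hom algebra_simps)
    finally show ?thesis by (simp add: sum_subtractf sum_distrib_left)
  qed
  have "0 = (\<Sum>i\<in>UNIV. \<Sum>j\<in>UNIV. (\<integral>v. L i j v \<partial>\<sigma>))" by (simp add: L0)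
  also have "\<dots> = (\<integral>v. (\<Sum>i\<in>UNIV. \<Sum>j\<in>UNIV. L i j v) \<partial>\<sigma>)"
    by (simp add: Lint)
  also have "\<dots> = (\<integral>v. (\<Sum>j\<in>UNIV. D j v (axis j 1)) - (real CARD('n) - 1 + \<kappa>) * (\<Sum>j\<in>UNIV. v $ j * X j v) \<partial>\<sigma>)"
    by (intro Bochner_Integration.integral_cong refl sum_L) (simp add: space_rotation_invariant[OF \<sigma>])
  also have "\<dots> = (\<integral>v. (\<Sum>j\<in>UNIV. D j v (axis j 1)) \<partial>\<sigma>) -
    (\<integral>v. (real CARD('n) - 1 + \<kappa>) * (\<Sum>j\<in>UNIV. v $ j * X j v) \<partial>\<sigma>)"
    by (intro Bochner_Integration.integral_diff integrable_continuous_on_sphere[OF \<sigma>] continuous_intros Xc Dc)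
  finally show ?thesis by simp
qed

section \<open>The powers |s|^p and the recursion in p\<close>

lemma continuous_on_abs_power:
  assumes "p \<ge> 0" "continuous_on S f"
  shows "continuous_on S (\<lambda>x. abs_power p (f x))"
proof (cases "p = 0")
  case False
  have "continuous_on UNIV (\<lambda>s::real. \<bar>s\<bar> powr p)"
    using assms(1) False by (intro continuous_on_powr' continuous_intros) auto
  then show ?thesis unfolding abs_power_def using False
    by (auto intro: continuous_on_compose2[OF _ assms(2)])
qed (simp add: abs_power_def)

lemma abs_power_add_two:
  assumes "p \<ge> 0"
  shows "abs_power (p + 2) s = s\<^sup>2 * abs_power p s"
  using assms by (cases "s = 0") (auto simp: abs_power_def powr_add)

text \<open>The factor s repairs the origin, where |s|^p need not be differentiable: the difference
  quotient there is |s|^p, which tends to 0 for p > 0. Elsewhere the power rule applies on a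
  half-line.\<close>

lemma has_derivative_mult_abs_power:
  assumes "p \<ge> 0"
  shows "((\<lambda>s. s * abs_power p s) has_real_derivative (p + 1) * abs_power p s) (at s)"
proof -
  consider "p = 0" | "p > 0" "s > 0" | "p > 0" "s = 0" | "p > 0" "s < 0" using assms by linarith
  then show ?thesis
  proof cases
    case 2
    have "((\<lambda>s. s powr (p + 1)) has_real_derivative (p + 1) * abs_power p s) (at s)"
      using has_real_derivative_powr[of s "p + 1"] 2 by (simp add: abs_power_def)
    then show ?thesis
      by (rule has_field_derivative_transform_within_open[of _ _ _ "{0<..}"])
        (use 2 in \<open>auto simp: abs_power_def powr_add\<close>)
  next
    case 4
    have "((\<lambda>s. - ((- s) powr (p + 1))) has_real_derivative (p + 1) * abs_power p s) (at s)"
      using DERIV_minus[OF DERIV_chain2[OF has_real_derivative_powr[of "- s" "p + 1"] DERIV_minus[OF DERIV_ident]]] 4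
      by (simp add: abs_power_def)
    then show ?thesis
      by (rule has_field_derivative_transform_within_open[of _ _ _ "{..<0}"])
        (use 4 in \<open>auto simp: abs_power_def powr_add\<close>)
  next
    case 3
    have "((\<lambda>s. \<bar>s\<bar> powr p) \<longlongrightarrow> \<bar>0\<bar> powr p) (at 0)"
      using 3 by (intro tendsto_intros) auto
    then have lim: "((\<lambda>s. \<bar>s\<bar> powr p) \<longlongrightarrow> 0) (at (0::real))" using 3 by simp
    have "\<forall>\<^sub>F s in at (0::real). \<bar>s\<bar> powr p = s * \<bar>s\<bar> powr p / s"
      by (simp add: eventually_at_filter)
    with lim have "((\<lambda>s. s * \<bar>s\<bar> powr p / s) \<longlongrightarrow> 0) (at (0::real))"
      by (rule Lim_transform_eventually)
    then show ?thesis using 3 by (simp add: abs_power_def has_field_derivative_iff)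
  qed (simp add: abs_power_def)
qed

text \<open>Splitting |s|^(p+2) as s (s |s|^p) allows two differentiations for every p >= 0, with
  the second derivative a multiple of |s|^p. This is why the recursion moves in steps of 2.\<close>

lemma has_derivative_abs_power_add_two:
  assumes "p \<ge> 0"
  shows "(abs_power (p + 2) has_real_derivative (p + 2) * (s * abs_power p s)) (at s)"
proof -
  have "abs_power (p + 2) = (\<lambda>s. s * (s * abs_power p s))"
    using abs_power_add_two[OF assms] by (auto simp: power2_eq_square)
  moreover have "((\<lambda>s. s * (s * abs_power p s)) has_real_derivative
     1 * (s * abs_power p s) + (p + 1) * abs_power p s * s) (at s)"
    by (intro DERIV_mult DERIV_ident has_derivative_mult_abs_power[OF assms])
  ultimately show ?thesis by (simp add: algebra_simps)
qed

text \<open>Apply the divergence theorem to \<open>f \<nabla>P - P \<nabla>f\<close> with \<open>f x = \<bar>u \<bullet> x\<bar>\<^sup>p\<^sup>+\<^sup>2\<close>, which is homogeneous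
  of degree \<open>p + l + 1\<close>.\<close>

lemma abs_power_integral_recursion:
  fixes P :: "real ^ 'n \<Rightarrow> real"
  assumes \<sigma>: "rotation_invariant_prob_on_sphere \<sigma>"
    and P: "homogeneous_polynomial l P" and harm: "\<And>x. laplacian P x = 0"
    and p: "p \<ge> 0" and u: "u \<in> sphere 0 1"
  shows "(p + 2) * (p + 1) * (\<integral>v. abs_power p (u \<bullet> v) * P v \<partial>\<sigma>) =
    (p + 2 - real l) * (p + real l + real CARD('n)) * (\<integral>v. abs_power (p + 2) (u \<bullet> v) * P v \<partial>\<sigma>)"
proof -
  obtain G H where G: "\<And>x. (P has_derivative (\<lambda>h. \<Sum>k\<in>UNIV. h $ k * G k x)) (at x)"
    and GE: "\<And>x. (\<Sum>k\<in>UNIV. x $ k * G k x) = real l * P x"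
    and H: "\<And>k x. (G k has_derivative H k x) (at x)"
    and HE: "\<And>k x. H k x x = (real l - 1) * G k x"
    and Hc: "\<And>k h. continuous_on UNIV (\<lambda>x. H k x h)"
    using homogeneous_polynomial_derivatives[OF P] by blast
  have lap: "(\<Sum>k\<in>UNIV. H k x (axis k 1)) = 0" for x
    using laplacian_has_derivative[OF G H] harm by simp
  have u1: "u \<bullet> u = 1" using u by (simp add: dot_square_norm)
  define A where "A x = abs_power p (u \<bullet> x)" for x
  define f where "f x = abs_power (p + 2) (u \<bullet> x)" for x
  \<comment> \<open>The gradient of \<open>f\<close> is \<open>e x\<close> times u, and that of
    \<open>e\<close> is (p + 2) (p + 1) \<open>A x\<close> times u.\<close>
  define e where "e x = (p + 2) * ((u \<bullet> x) * A x)" for x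
  have f_A: "f x = (u \<bullet> x)\<^sup>2 * A x" for x
    by (simp add: f_def A_def abs_power_add_two[OF p])
  have df: "(f has_derivative (\<lambda>h. (u \<bullet> h) * e x)) (at x)" for x
  proof -
    have "((\<lambda>x. u \<bullet> x) has_derivative (\<lambda>h. u \<bullet> h)) (at x)"
      by (auto intro!: derivative_eq_intros)
    from has_derivative_compose[OF this has_derivative_abs_power_add_two[OF p, unfolded has_field_derivative_def]]
    show ?thesis by (simp add: f_def[abs_def] e_def A_def mult_ac)
  qed
  have de: "(e has_derivative (\<lambda>h. (u \<bullet> h) * ((p + 2) * (p + 1) * A x))) (at x)" for x
  proof -
    have "((\<lambda>x. u \<bullet> x) has_derivative (\<lambda>h. u \<bullet> h)) (at x)"
      by (auto intro!: derivative_eq_intros)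
    from has_derivative_mult_right[OF has_derivative_compose[OF this has_derivative_mult_abs_power[OF p, unfolded has_field_derivative_def]],
      of "p + 2"]
    show ?thesis by (simp add: e_def[abs_def] A_def mult_ac)
  qed
  have Ac: "continuous_on S A" for S
    unfolding A_def by (intro continuous_on_abs_power p continuous_intros)
  have fc: "continuous_on S f" for S
    using df by (meson has_derivative_continuous continuous_at_imp_continuous_on)
  have ec: "continuous_on S e" for S
    using de by (meson has_derivative_continuous continuous_at_imp_continuous_on)
  have Pc: "continuous_on S P" for S
    using G by (meson has_derivative_continuous continuous_at_imp_continuous_on)
  have Gc: "continuous_on S (G k)" for S k
    using H by (meson has_derivative_continuous continuous_at_imp_continuous_on)
  define X where "X j x = f x * G j x - P x * (u $ j * e x)" for j x
  define D where "D j x h = (f x * H j x h + (u \<bullet> h) * e x * G j x) -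
     (P x * (u $ j * ((u \<bullet> h) * ((p + 2) * (p + 1) * A x))) + (\<Sum>k\<in>UNIV. h $ k * G k x) * (u $ j * e x))" for j x h
  \<comment> \<open>This and \<open>uxA\<close> are Euler's relations for \<open>f\<close> and
    \<open>e\<close>, of degrees p + 2 and p + 1.\<close>
  have uxe: "(u \<bullet> x) * e x = (p + 2) * f x" for x
    by (simp add: e_def f_A power2_eq_square)
  have uxA: "(u \<bullet> x) * ((p + 2) * (p + 1) * A x) = (p + 1) * e x" for x
    by (simp add: e_def)
  have usum: "(\<Sum>k\<in>UNIV. v $ k * u $ k) = u \<bullet> v" for v
    by (simp add: inner_vec_def mult.commute)
  have gauss: "(\<integral>v. (\<Sum>j\<in>UNIV. D j v (axis j 1)) \<partial>\<sigma>) =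
    (real CARD('n) - 1 + (p + real l + 1)) * (\<integral>v. (\<Sum>j\<in>UNIV. v $ j * X j v) \<partial>\<sigma>)"
  proof (rule integral_divergence_sphere[OF \<sigma>])
    show "(X j has_derivative D j x) (at x)" for j x
      unfolding X_def[abs_def] D_def[abs_def]
      by (intro has_derivative_diff has_derivative_mult df H G has_derivative_mult_right de)
    have "continuous_on UNIV (\<lambda>x. H j x h)" for j h by (rule Hc)
    then show "continuous_on UNIV (\<lambda>x. D j x h)" for j h
      unfolding D_def by (intro continuous_intros Ac fc ec Pc Gc)
    show "D j x x = (p + real l + 1) * X j x" for j x
      unfolding D_def X_def uxA uxe GE HE by (simp add: algebra_simps)
  qed
  \<comment> \<open>The products of the two gradients cancel, leaving f \<Delta>P - P \<Delta>f.
    Here \<Delta>P = 0, and \<Delta>f = (p + 2) (p + 1) A because u is a unit vector.\<close>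
  have div: "(\<Sum>j\<in>UNIV. D j v (axis j 1)) = - ((p + 2) * (p + 1)) * (A v * P v)" for v
  proof -
    have "D j v (axis j 1) = f v * H j v (axis j 1) - ((u $ j * u $ j) * (P v * ((p + 2) * (p + 1) * A v)))" for j
    proof -
      have "(\<Sum>k\<in>UNIV. axis j 1 $ k * G k v) = G j v"
        by (simp add: axis_def if_distrib[of "\<lambda>c. c * _"] cong: if_cong)
      then show ?thesis by (simp add: D_def inner_axis)
    qed
    then have "(\<Sum>j\<in>UNIV. D j v (axis j 1)) = f v * (\<Sum>j\<in>UNIV. H j v (axis j 1))
       - ((\<Sum>j\<in>UNIV. u $ j * u $ j) * (P v * ((p + 2) * (p + 1) * A v)))"
      by (simp add: sum_subtractf sum_distrib_left sum_distrib_right)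
    then show ?thesis unfolding lap usum u1 by simp
  qed
  have radial: "(\<Sum>j\<in>UNIV. v $ j * X j v) = (real l - (p + 2)) * (f v * P v)" for v
  proof -
    have "(\<Sum>j\<in>UNIV. v $ j * X j v) = f v * (\<Sum>j\<in>UNIV. v $ j * G j v) - P v * ((\<Sum>j\<in>UNIV. v $ j * u $ j) * e v)"
      by (simp add: X_def sum_subtractf sum_distrib_left sum_distrib_right algebra_simps)
    then show ?thesis unfolding usum uxe GE by (simp add: algebra_simps)
  qed
  define I J where "I = (\<integral>v. A v * P v \<partial>\<sigma>)" and "J = (\<integral>v. f v * P v \<partial>\<sigma>)"
  have "- ((p + 2) * (p + 1)) * I = (real CARD('n) - 1 + (p + real l + 1)) * ((real l - (p + 2)) * J)"
    using gauss unfolding div radial by (simp add: I_def J_def)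
  then have "(p + 2) * (p + 1) * I = (p + 2 - real l) * (p + real l + real CARD('n)) * J"
    by (simp add: algebra_simps)
  then show ?thesis by (simp add: I_def J_def A_def f_def)
qed

subsection \<open>Concentration at the poles and the multipliers\<close>

lemma continuous_on_homogeneous_polynomial:
  fixes P :: "real ^ 'n \<Rightarrow> real"
  assumes "homogeneous_polynomial l P"
  shows "continuous_on S P"
proof -
  obtain G where "\<And>x. (P has_derivative (\<lambda>h. \<Sum>k\<in>UNIV. h $ k * G k x)) (at x)"
    by (rule homogeneous_polynomial_derivatives[OF assms]) (rule that)
  then show ?thesis by (meson has_derivative_continuous continuous_at_imp_continuous_on)
qed

lemma homogeneous_polynomial_uminus:
  assumes "homogeneous_polynomial l P"
  shows "P (- x) = (- 1) ^ l * P x"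
proof -
  obtain c where c: "\<And>x. P x = (\<Sum>\<alpha> | (\<Sum>i\<in>UNIV. \<alpha> i) = l. c \<alpha> * (\<Prod>i\<in>UNIV. (x $ i) ^ \<alpha> i))"
    using assms unfolding homogeneous_polynomial_def by blast
  have "(\<Prod>i\<in>UNIV. ((- x) $ i) ^ \<alpha> i) = (- 1) ^ (\<Sum>i\<in>UNIV. \<alpha> i) * (\<Prod>i\<in>UNIV. (x $ i) ^ \<alpha> i)" for \<alpha>
    by (simp add: power_minus[of "x $ _"] prod.distrib power_sum)
  then show ?thesis unfolding c sum_distrib_left by (intro sum.cong) auto
qed

lemma laplacian_one: "laplacian (\<lambda>_ :: real ^ 'n. 1) x = 0"
proof -
  have "partial_derivative i (\<lambda>_. c) = (\<lambda>_. 0)" for i :: 'n and c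
    by (simp add: partial_derivative_def fun_eq_iff)
  then show ?thesis by (simp add: laplacian_def)
qed

section \<open>The masses of the zonal weights\<close>

definition zonal_mass :: "(real ^ 'n) measure \<Rightarrow> real ^ 'n \<Rightarrow> real \<Rightarrow> real" where
  "zonal_mass \<sigma> u p = (\<integral>v. abs_power p (u \<bullet> v) \<partial>\<sigma>)"

lemma integrable_abs_power:
  assumes "rotation_invariant_prob_on_sphere \<sigma>" "p \<ge> 0" "continuous_on (sphere 0 1) g"
  shows "integrable \<sigma> (\<lambda>v. abs_power p (u \<bullet> v) * g v)"
  by (intro integrable_continuous_on_sphere[OF assms(1)] continuous_intros continuous_on_abs_power assms)

text \<open>The case P = 1, l = 0 of the general recursion, with the positive factor p + 2
  cancelled.\<close>

lemma zonal_mass_recursion: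
  assumes \<sigma>: "rotation_invariant_prob_on_sphere (\<sigma> :: (real ^ 'n) measure)"
    and p: "p \<ge> 0" and u: "u \<in> sphere 0 1"
  shows "(p + 1) * zonal_mass \<sigma> u p = (p + real CARD('n)) * zonal_mass \<sigma> u (p + 2)"
  using abs_power_integral_recursion[OF \<sigma> homogeneous_polynomial_one laplacian_one p u] p
  by (simp add: zonal_mass_def mult.assoc)

text \<open>The mass is 1 at exponent 0, and the recursion carries positivity to all even exponents.
  Since |u . v| <= 1, a larger even exponent gives a lower bound for the mass at p.\<close>

lemma zonal_mass_pos:
  assumes \<sigma>: "rotation_invariant_prob_on_sphere (\<sigma> :: (real ^ 'n) measure)"
    and p: "p \<ge> 0" and u: "u \<in> sphere 0 1"
  shows "zonal_mass \<sigma> u p > 0"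
proof -
  interpret prob_space \<sigma> using \<sigma> by (simp add: rotation_invariant_prob_on_sphere_def)
  have even: "zonal_mass \<sigma> u (2 * real m) > 0" for m
  proof (induction m)
    case 0
    show ?case by (simp add: zonal_mass_def abs_power_def prob_space)
  next
    case (Suc m)
    have "(2 * real m + 1) * zonal_mass \<sigma> u (2 * real m) > 0"
      using Suc by (intro mult_pos_pos) auto
    also have "\<dots> = (2 * real m + real CARD('n)) * zonal_mass \<sigma> u (2 * real (Suc m))"
      using zonal_mass_recursion[OF \<sigma> _ u, of "2 * real m"] by (simp add: add.commute)
    finally show ?case by (simp add: zero_less_mult_iff)
  qed
  obtain m :: nat where "p / 2 \<le> real m"
    using real_arch_simple by blast
  then have m: "p \<le> 2 * real m" by simp
  \<comment> \<open>\<open>Suc m\<close> keeps the larger exponent away from 0, where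
    \<open>abs_power\<close> has its separate clause.\<close>
  have "zonal_mass \<sigma> u (2 * real (Suc m)) \<le> zonal_mass \<sigma> u p"
    unfolding zonal_mass_def
  proof (rule integral_mono)
    show "integrable \<sigma> (\<lambda>v. abs_power (2 * real (Suc m)) (u \<bullet> v))" "integrable \<sigma> (\<lambda>v. abs_power p (u \<bullet> v))"
      using integrable_abs_power[OF \<sigma> _ continuous_on_const[where c = 1], of _ u] p by auto
    fix v assume "v \<in> space \<sigma>"
    then have "\<bar>u \<bullet> v\<bar> \<le> 1"
      using Cauchy_Schwarz_ineq2[of u v] u by (simp add: space_rotation_invariant[OF \<sigma>])
    then show "abs_power (2 * real (Suc m)) (u \<bullet> v) \<le> abs_power p (u \<bullet> v)"
      using m p by (auto simp: abs_power_def intro!: powr_le1 powr_mono')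
  qed
  with even[of "Suc m"] show ?thesis by simp
qed

text \<open>In dimension at least 2 a rotation takes w to u. This makes the scalar in the Funk-Hecke
  identity independent of the point u.\<close>

lemma zonal_mass_cong:
  assumes d: "CARD('n) \<ge> 2" and \<sigma>: "rotation_invariant_prob_on_sphere (\<sigma> :: (real ^ 'n) measure)"
    and p: "p \<ge> 0" and u: "u \<in> sphere 0 1" and w: "w \<in> sphere 0 1"
  shows "zonal_mass \<sigma> u p = zonal_mass \<sigma> w p"
proof -
  have "norm w = norm u" using u w by simp
  then obtain T where T: "orthogonal_transformation T" "det (matrix T) = 1" "T w = u"
    using rotation_exists[OF d] by metis
  then have rot: "rotation T" by (simp add: rotation_def)
  have "zonal_mass \<sigma> u p = (\<integral>v. abs_power p (T w \<bullet> T v) \<partial>\<sigma>)"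
    unfolding zonal_mass_def T(3)
    by (intro integral_rotation[OF \<sigma> rot, symmetric] continuous_on_abs_power p continuous_intros)
  also have "\<dots> = zonal_mass \<sigma> w p"
    using T(1) by (simp add: zonal_mass_def orthogonal_transformation_def)
  finally show ?thesis .
qed

text \<open>On the sphere \<open>\<bar>v \<mp> u\<bar>\<^sup>2 \<le> 2 (1 - (u \<bullet> v)\<^sup>2)\<close> for the sign of \<open>u \<bullet> v\<close>.\<close>

lemma near_poles_bound:
  fixes g :: "real ^ 'n \<Rightarrow> real"
  assumes g: "continuous_on (sphere 0 1) g" and u: "u \<in> sphere 0 1"
    and a: "g u = a" "g (- u) = a" and \<epsilon>: "\<epsilon> > 0"
  obtains C where "C \<ge> 0" "\<And>v. v \<in> sphere 0 1 \<Longrightarrow> \<bar>g v - a\<bar> \<le> \<epsilon> + C * (1 - (u \<bullet> v)\<^sup>2)"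
proof -
  have mu: "- u \<in> sphere 0 1" using u by simp
  obtain \<delta>1 where \<delta>1: "\<delta>1 > 0" "\<And>v. v \<in> sphere 0 1 \<Longrightarrow> dist v u < \<delta>1 \<Longrightarrow> dist (g v) (g u) < \<epsilon>"
    using g u \<epsilon> unfolding continuous_on_iff by metis
  obtain \<delta>2 where \<delta>2: "\<delta>2 > 0" "\<And>v. v \<in> sphere 0 1 \<Longrightarrow> dist v (- u) < \<delta>2 \<Longrightarrow> dist (g v) (g (- u)) < \<epsilon>"
    using g mu \<epsilon> unfolding continuous_on_iff by metis
  define \<delta> where "\<delta> = min \<delta>1 \<delta>2"
  have \<delta>0: "\<delta> > 0" using \<delta>1 \<delta>2 by (simp add: \<delta>_def)
  have "bounded (g ` sphere 0 1)"
    by (intro compact_imp_bounded compact_continuous_image g compact_sphere)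
  then obtain B where "\<forall>y\<in>g ` sphere 0 1. norm y \<le> B"
    unfolding bounded_iff by (rule exE)
  then have B: "\<bar>g v\<bar> \<le> B" if "v \<in> sphere 0 1" for v
    using that by (metis imageI real_norm_def)
  have B0: "B \<ge> 0" using B[OF u] by linarith
  \<comment> \<open>Near a pole \<epsilon> alone suffices. Away from both, |g v - a| is at most 2 B
    while 2 (1 - (u . v)^2) is at least \<delta>^2, which dictates the constant.\<close>
  show thesis
  proof (rule that[of "4 * B / \<delta>\<^sup>2"])
    show "4 * B / \<delta>\<^sup>2 \<ge> 0" using B0 by simp
    fix v :: "real ^ 'n" assume v: "v \<in> sphere 0 1"
    have nv: "norm v = 1" "norm u = 1" using u v by auto
    have uv1: "u \<bullet> u = 1" "v \<bullet> v = 1" using nv by (simp_all add: dot_square_norm)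
    have s1: "\<bar>u \<bullet> v\<bar> \<le> 1" using Cauchy_Schwarz_ineq2[of u v] nv by simp
    then have s2: "(u \<bullet> v)\<^sup>2 \<le> 1" by (simp add: abs_square_le_1)
    have e1: "(dist v u)\<^sup>2 = 2 - 2 * (u \<bullet> v)"
      by (simp add: dist_norm power2_norm_eq_inner inner_diff inner_commute uv1)
    have e2: "(dist v (- u))\<^sup>2 = 2 + 2 * (u \<bullet> v)"
      by (simp add: dist_norm power2_norm_eq_inner inner_add inner_commute uv1)
    show "\<bar>g v - a\<bar> \<le> \<epsilon> + 4 * B / \<delta>\<^sup>2 * (1 - (u \<bullet> v)\<^sup>2)"
    proof (cases "dist v u < \<delta> \<or> dist v (- u) < \<delta>")
      case True
      then have "\<bar>g v - a\<bar> < \<epsilon>"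
        using \<delta>1(2)[OF v] \<delta>2(2)[OF v] a by (auto simp: \<delta>_def dist_real_def)
      moreover have "4 * B / \<delta>\<^sup>2 * (1 - (u \<bullet> v)\<^sup>2) \<ge> 0" using B0 s2 by simp
      ultimately show ?thesis by linarith
    next
      case False
      then have "\<delta>\<^sup>2 \<le> 2 - 2 * (u \<bullet> v)" "\<delta>\<^sup>2 \<le> 2 + 2 * (u \<bullet> v)"
        unfolding e1[symmetric] e2[symmetric] using \<delta>0 by (auto intro!: power_mono)
      then have "\<delta>\<^sup>2 \<le> 2 * (1 - \<bar>u \<bullet> v\<bar>)" by (simp add: abs_if)
      also have "\<dots> \<le> 2 * (1 - (u \<bullet> v)\<^sup>2)"
        using s1 mult_left_le[of "\<bar>u \<bullet> v\<bar>" "\<bar>u \<bullet> v\<bar>"] by (simp add: power2_eq_square)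
      finally have "1 \<le> 2 * (1 - (u \<bullet> v)\<^sup>2) / \<delta>\<^sup>2" using \<delta>0 by simp
      then have "2 * B * 1 \<le> 2 * B * (2 * (1 - (u \<bullet> v)\<^sup>2) / \<delta>\<^sup>2)" using B0 by (intro mult_left_mono) auto
      moreover have "\<bar>g v - a\<bar> \<le> 2 * B" using B[OF v] B[OF u] a by linarith
      moreover have "2 * B * (2 * (1 - (u \<bullet> v)\<^sup>2) / \<delta>\<^sup>2) = 4 * B / \<delta>\<^sup>2 * (1 - (u \<bullet> v)\<^sup>2)"
        by simp
      ultimately show ?thesis using \<epsilon> by linarith
    qed
  qed
qed

text \<open>The normalised weights concentrate at the poles because their mean of \<open>1 - (u \<bullet> v)\<^sup>2\<close> is
  \<open>(d - 1) / (q + d)\<close>, by the recursion for the masses.\<close>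

lemma zonal_average_bound:
  fixes g :: "real ^ 'n \<Rightarrow> real"
  assumes \<sigma>: "rotation_invariant_prob_on_sphere \<sigma>" and g: "continuous_on (sphere 0 1) g"
    and u: "u \<in> sphere 0 1" and p: "p \<ge> 0"
    and bound: "\<And>v. v \<in> sphere 0 1 \<Longrightarrow> \<bar>g v - a\<bar> \<le> \<epsilon> + C * (1 - (u \<bullet> v)\<^sup>2)"
  shows "\<bar>(\<integral>v. abs_power p (u \<bullet> v) * g v \<partial>\<sigma>) / zonal_mass \<sigma> u p - a\<bar> \<le>
    \<epsilon> + C * (real CARD('n) - 1) / (p + real CARD('n))"
proof -
  let ?A = "\<lambda>v. abs_power p (u \<bullet> v)" and ?d = "real CARD('n)"
  define Z where "Z = zonal_mass \<sigma> u p"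
  have Z0: "Z > 0" unfolding Z_def by (rule zonal_mass_pos[OF \<sigma> p u])
  have d0: "p + ?d > 0" using p by (simp add: add_nonneg_pos)
  have A0: "?A v \<ge> 0" for v by (simp add: abs_power_def)
  have ZA: "Z = (\<integral>v. ?A v * 1 \<partial>\<sigma>)" by (simp add: Z_def zonal_mass_def)
  have iA: "integrable \<sigma> (\<lambda>v. ?A v * h v)" if "continuous_on (sphere 0 1) h" for h
    by (rule integrable_abs_power[OF \<sigma> p that])
  have "(\<integral>v. ?A v * g v \<partial>\<sigma>) - a * Z = (\<integral>v. ?A v * g v - a * (?A v * 1) \<partial>\<sigma>)"
    unfolding ZA by (subst Bochner_Integration.integral_diff[OF iA[OF g] integrable_mult_right[OF iA[OF continuous_on_const]]])
      (simp only: integral_mult_right_zero)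
  also have "\<dots> = (\<integral>v. ?A v * (g v - a) \<partial>\<sigma>)"
    by (simp add: algebra_simps)
  finally have "\<bar>(\<integral>v. ?A v * g v \<partial>\<sigma>) - a * Z\<bar> \<le> (\<integral>v. norm (?A v * (g v - a)) \<partial>\<sigma>)"
    using integral_norm_bound[of \<sigma> "\<lambda>v. ?A v * (g v - a)"] by simp
  also have "\<dots> \<le> (\<integral>v. ?A v * (\<epsilon> + C * (1 - (u \<bullet> v)\<^sup>2)) \<partial>\<sigma>)"
  proof (rule integral_mono)
    show "integrable \<sigma> (\<lambda>v. norm (?A v * (g v - a)))"
      by (intro integrable_norm iA continuous_intros g)
    show "integrable \<sigma> (\<lambda>v. ?A v * (\<epsilon> + C * (1 - (u \<bullet> v)\<^sup>2)))"
      by (intro iA continuous_intros)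
    fix v assume "v \<in> space \<sigma>"
    then show "norm (?A v * (g v - a)) \<le> ?A v * (\<epsilon> + C * (1 - (u \<bullet> v)\<^sup>2))"
      using bound A0 by (simp add: space_rotation_invariant[OF \<sigma>] abs_mult mult_left_mono)
  qed
  \<comment> \<open>The factor (u . v)^2 raises the exponent to p + 2. The factors 1 give both
    integrands the shape of \<open>integrable_abs_power\<close>.\<close>
  also have "\<dots> = (\<integral>v. (\<epsilon> + C) * (?A v * 1) - C * (abs_power (p + 2) (u \<bullet> v) * 1) \<partial>\<sigma>)"
    by (simp add: abs_power_add_two[OF p] algebra_simps)
  also have "\<dots> = (\<epsilon> + C) * Z - C * zonal_mass \<sigma> u (p + 2)"
    unfolding ZA
    by (subst Bochner_Integration.integral_diff[OF integrable_mult_right[OF iA[OF continuous_on_const]]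
          integrable_mult_right[OF integrable_abs_power[OF \<sigma> _ continuous_on_const]]])
      (use p in \<open>simp_all add: zonal_mass_def\<close>)
  also have "zonal_mass \<sigma> u (p + 2) = (p + 1) / (p + ?d) * Z"
    using zonal_mass_recursion[OF \<sigma> p u] d0 by (simp add: Z_def field_simps)
  \<comment> \<open>Uses 1 - (p + 1) / (p + d) = (d - 1) / (p + d).\<close>
  also have "(\<epsilon> + C) * Z - C * ((p + 1) / (p + ?d) * Z) = (\<epsilon> + C * (?d - 1) / (p + ?d)) * Z"
    using d0 by (simp add: field_simps)
  finally have "\<bar>(\<integral>v. ?A v * g v \<partial>\<sigma>) - a * Z\<bar> / Z \<le> (\<epsilon> + C * (?d - 1) / (p + ?d)) * Z / Z"
    using Z0 by (intro divide_right_mono) auto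
  moreover have "(\<integral>v. ?A v * g v \<partial>\<sigma>) / Z - a = ((\<integral>v. ?A v * g v \<partial>\<sigma>) - a * Z) / Z"
    using Z0 by (simp add: field_simps)
  ultimately show ?thesis using Z0 unfolding Z_def[symmetric] by (simp add: abs_divide)
qed

text \<open>Half of the tolerance fixes the constant C; the remaining term decays as the exponent
  grows. The even weights do not separate u from - u, hence one common value at both poles.\<close>

lemma zonal_average_tendsto:
  fixes g :: "real ^ 'n \<Rightarrow> real"
  assumes \<sigma>: "rotation_invariant_prob_on_sphere \<sigma>" and g: "continuous_on (sphere 0 1) g"
    and u: "u \<in> sphere 0 1" and p: "p \<ge> 0" and a: "g u = a" "g (- u) = a"
  shows "(\<lambda>k. (\<integral>v. abs_power (p + 2 * real k) (u \<bullet> v) * g v \<partial>\<sigma>) / zonal_mass \<sigma> u (p + 2 * real k))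
    \<longlonglongrightarrow> a"
proof (rule LIMSEQ_I)
  fix r :: real assume r: "r > 0"
  then obtain C where C: "C \<ge> 0" "\<And>v. v \<in> sphere 0 1 \<Longrightarrow> \<bar>g v - a\<bar> \<le> r / 2 + C * (1 - (u \<bullet> v)\<^sup>2)"
    using near_poles_bound[OF g u a, of "r / 2"] by (metis half_gt_zero)
  have "(\<lambda>k. C * (real CARD('n) - 1) / (p + 2 * real k + real CARD('n))) \<longlonglongrightarrow> 0"
    by real_asymp
  then have "\<forall>\<^sub>F k in sequentially. C * (real CARD('n) - 1) / (p + 2 * real k + real CARD('n)) < r / 2"
    using r by (intro order_tendstoD(2)) auto
  then show "\<exists>N. \<forall>k\<ge>N. norm ((\<integral>v. abs_power (p + 2 * real k) (u \<bullet> v) * g v \<partial>\<sigma>)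
      / zonal_mass \<sigma> u (p + 2 * real k) - a) < r"
    unfolding eventually_sequentially
  proof (elim exE, intro exI allI impI)
    fix N k assume "\<forall>k\<ge>N. C * (real CARD('n) - 1) / (p + 2 * real k + real CARD('n)) < r / 2" "N \<le> k"
    then have "C * (real CARD('n) - 1) / (p + 2 * real k + real CARD('n)) < r / 2" by blast
    moreover have "p + 2 * real k \<ge> 0" using p by simp
    note zonal_average_bound[OF \<sigma> g u this C(2)]
    ultimately show "norm ((\<integral>v. abs_power (p + 2 * real k) (u \<bullet> v) * g v \<partial>\<sigma>)
      / zonal_mass \<sigma> u (p + 2 * real k) - a) < r" unfolding real_norm_def by linarith
  qed
qed

section \<open>The infinite product\<close>

text \<open>The quotient of the recursion coefficients for degree l and for P = 1 at the exponent q
  = p + 2 k, after cancelling q + 1.\<close>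

definition funk_hecke_factor :: "nat \<Rightarrow> nat \<Rightarrow> real \<Rightarrow> nat \<Rightarrow> real" where
  "funk_hecke_factor d l p k = (p + 2 * real k + 2 - real l) * (p + 2 * real k + real l + real d) /
     ((p + 2 * real k + 2) * (p + 2 * real k + real d))"

text \<open>With q = p + 2 k, the k-th factor differs from 1 by - l (l + d - 2) / ((q + 2) (q + d)),
  which is of order 1 / k^2, so the product converges absolutely.\<close>

lemma convergent_prod_funk_hecke_factor:
  assumes "p \<ge> 0" "d \<ge> 2"
  shows "convergent_prod (funk_hecke_factor d l p)"
proof (rule abs_convergent_prod_imp_convergent_prod, unfold abs_convergent_prod_conv_summable,
    rule summable_comparison_test_ev)
  define c where "c = real l * (real l + real d - 2)"
  have c0: "c \<ge> 0" using assms by (simp add: c_def)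
  show "summable (\<lambda>k. c * (1 / real (k ^ 2)))"
    using inverse_power_summable[of 2, where 'a = real]
    by (intro summable_mult) (simp add: inverse_eq_divide)
  show "\<forall>\<^sub>F k in sequentially. norm (norm (funk_hecke_factor d l p k - 1)) \<le> c * (1 / real (k ^ 2))"
    \<comment> \<open>At k = 0 the comparison term is 0, because division by 0 yields 0, so the
      bound is claimed only for k > 0.\<close>
    using eventually_gt_at_top[of 0]
  proof eventually_elim
    fix k :: nat assume k: "k > 0"
    let ?q = "p + 2 * real k"
    have pos: "?q + 2 > 0" "?q + real d > 0" using assms k by (auto intro: add_nonneg_pos)
    have "funk_hecke_factor d l p k - 1 = ((?q + 2 - real l) * (?q + real l + real d) - (?q + 2) * (?q + real d)) / ((?q + 2) * (?q + real d))"
      using pos by (simp add: funk_hecke_factor_def diff_divide_distrib)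
    also have "(?q + 2 - real l) * (?q + real l + real d) - (?q + 2) * (?q + real d) = - c"
      by (simp add: c_def algebra_simps)
    finally have "norm (funk_hecke_factor d l p k - 1) = c / ((?q + 2) * (?q + real d))"
      using pos c0 by (simp add: abs_mult)
    also have "\<dots> \<le> c / (real k * real k)"
      using k pos assms c0 by (intro divide_left_mono mult_mono) auto
    finally show "norm (norm (funk_hecke_factor d l p k - 1)) \<le> c * (1 / real (k ^ 2))"
      by (simp add: power2_eq_square)
  qed
qed

text \<open>A convergent product vanishes exactly if one of its factors does, and p + 2 k + 2 - l is
  the only part of a factor that can be 0.\<close>

lemma prodinf_funk_hecke_factor_eq_0_iff:
  assumes "p \<ge> 0" "d \<ge> 2"
  shows "prodinf (funk_hecke_factor d l p) = 0 \<longleftrightarrow> (\<exists>k. p + 2 * real k + 2 = real l)"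
proof -
  note conv = convergent_prod_funk_hecke_factor[OF assms, of l]
  have zero: "funk_hecke_factor d l p k = 0 \<longleftrightarrow> p + 2 * real k + 2 = real l" for k
    using assms by (auto simp: funk_hecke_factor_def add_nonneg_eq_0_iff)
  show ?thesis
  proof
    assume "prodinf (funk_hecke_factor d l p) = 0"
    then show "\<exists>k. p + 2 * real k + 2 = real l"
      using prodinf_nonzero[OF conv] zero by blast
  next
    assume "\<exists>k. p + 2 * real k + 2 = real l"
    then obtain k where k: "funk_hecke_factor d l p k = 0" using zero by blast
    have "(\<lambda>n. \<Prod>i\<le>n. funk_hecke_factor d l p i) \<longlonglongrightarrow> 0"
    proof (rule tendsto_eventually)
      show "\<forall>\<^sub>F n in sequentially. (\<Prod>i\<le>n. funk_hecke_factor d l p i) = 0"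
        using eventually_ge_at_top[of k] by eventually_elim (use k in auto)
    qed
    with convergent_prod_LIMSEQ[OF conv] show "prodinf (funk_hecke_factor d l p) = 0"
      by (rule LIMSEQ_unique)
  qed
qed

lemma abs_power_integral_prod:
  fixes P :: "real ^ 'n \<Rightarrow> real"
  assumes \<sigma>: "rotation_invariant_prob_on_sphere \<sigma>"
    and P: "homogeneous_polynomial l P" and harm: "\<And>x. laplacian P x = 0"
    and p: "p \<ge> 0" and u: "u \<in> sphere 0 1"
  shows "(\<integral>v. abs_power p (u \<bullet> v) * P v \<partial>\<sigma>) / zonal_mass \<sigma> u p =
    (\<Prod>k<N. funk_hecke_factor CARD('n) l p k) *
    ((\<integral>v. abs_power (p + 2 * real N) (u \<bullet> v) * P v \<partial>\<sigma>) / zonal_mass \<sigma> u (p + 2 * real N))"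
proof (induction N)
  case (Suc N)
  define q where "q = p + 2 * real N"
  have q: "q \<ge> 0" using p by (simp add: q_def)
  have q2: "p + 2 * real (Suc N) = q + 2" by (simp add: q_def)
  define F where "F r = (\<integral>v. abs_power r (u \<bullet> v) * P v \<partial>\<sigma>)" for r
  define Z where "Z r = zonal_mass \<sigma> u r" for r
  define c where "c = (q + 2 - real l) * (q + real l + real CARD('n))"
  have d0: "q + real CARD('n) > 0" using q by (simp add: add_nonneg_pos)
  have Zpos: "Z r > 0" if "r \<ge> 0" for r unfolding Z_def by (rule zonal_mass_pos[OF \<sigma> that u])
  have rec: "(q + 2) * (q + 1) * F q = c * F (q + 2)"
    unfolding F_def c_def by (rule abs_power_integral_recursion[OF \<sigma> P harm q u])
  have recZ: "(q + 1) * Z q = (q + real CARD('n)) * Z (q + 2)"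
    unfolding Z_def by (rule zonal_mass_recursion[OF \<sigma> q u])
  \<comment> \<open>Numerator and denominator are expanded by (q + 2) (q + 1) so that both
    recursions apply.\<close>
  have "F q / Z q = ((q + 2) * (q + 1) * F q) / ((q + 2) * ((q + 1) * Z q))"
    using q by simp
  also have "\<dots> = c / ((q + 2) * (q + real CARD('n))) * (F (q + 2) / Z (q + 2))"
    unfolding rec recZ by simp
  also have "c / ((q + 2) * (q + real CARD('n))) = funk_hecke_factor CARD('n) l p N"
    by (simp add: funk_hecke_factor_def c_def q_def)
  finally have "F q / Z q = funk_hecke_factor CARD('n) l p N * (F (q + 2) / Z (q + 2))" .
  moreover have "F p / Z p = (\<Prod>k<N. funk_hecke_factor CARD('n) l p k) * (F q / Z q)"
    using Suc by (simp only: F_def Z_def q_def)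
  ultimately have "F p / Z p = (\<Prod>k<Suc N. funk_hecke_factor CARD('n) l p k) * (F (q + 2) / Z (q + 2))"
    by (simp only: prod.lessThan_Suc mult.assoc)
  then show ?case unfolding q2 by (simp only: F_def Z_def)
qed simp

text \<open>P is symmetrised so that both poles carry the same value. The normalised integral at p
  then equals each partial product times the normalised integral at a higher exponent, and both have
  limits.\<close>

lemma funk_hecke_abs_power:
  fixes P :: "real ^ 'n \<Rightarrow> real"
  assumes d: "CARD('n) \<ge> 2" and \<sigma>: "rotation_invariant_prob_on_sphere \<sigma>"
    and P: "homogeneous_polynomial l P" and harm: "\<And>x. laplacian P x = 0"
    and p: "p \<ge> 0" and u: "u \<in> sphere 0 1"
  shows "(\<integral>v. abs_power p (u \<bullet> v) * P v \<partial>\<sigma>) =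
    (if even l then zonal_mass \<sigma> u p * prodinf (funk_hecke_factor CARD('n) l p) else 0) * P u"
proof -
  have Pc: "continuous_on S P" for S by (rule continuous_on_homogeneous_polynomial[OF P])
  have "norm u = norm (- u)" by simp
  \<comment> \<open>The antipodal map has determinant -1 in odd dimensions, so a rotation that swaps
    u and - u takes its place.\<close>
  then obtain T where T: "orthogonal_transformation T" "det (matrix T) = 1" "T u = - u"
    using rotation_exists[OF d] by metis
  have rot: "rotation T" using T by (simp add: rotation_def)
  have lin: "linear T" using T(1) by (rule orthogonal_transformation_linear)
  then have Tc: "continuous_on S T" for S
    by (intro linear_continuous_on linear_conv_bounded_linear[THEN iffD1])
  have Tu: "T (- u) = u" using T(3) linear_neg[OF lin, of u] by simp
  define g where "g v = (P v + P (T v)) / 2" for v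
  have PTc: "continuous_on S (\<lambda>v. P (T v))" for S
    by (rule continuous_on_compose2[OF Pc[of UNIV] Tc]) simp
  have gc: "continuous_on S g" for S
    unfolding g_def by (intro continuous_intros Pc PTc) simp
  have sym: "(\<integral>v. abs_power q (u \<bullet> v) * P v \<partial>\<sigma>) = (\<integral>v. abs_power q (u \<bullet> v) * g v \<partial>\<sigma>)"
    if q: "q \<ge> 0" for q
  proof -
    have even_u: "abs_power q (u \<bullet> T v) = abs_power q (u \<bullet> v)" for v
    proof -
      have "u \<bullet> T v = T (- u) \<bullet> T v" by (simp add: Tu)
      also have "\<dots> = - (u \<bullet> v)" using T(1) by (simp add: orthogonal_transformation_def)
      finally show ?thesis by (simp add: abs_power_def)
    qed
    have "(\<integral>v. abs_power q (u \<bullet> T v) * P (T v) \<partial>\<sigma>) = (\<integral>v. abs_power q (u \<bullet> v) * P v \<partial>\<sigma>)"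
      by (intro integral_rotation[OF \<sigma> rot] continuous_intros continuous_on_abs_power q Pc)
    then have "(\<integral>v. abs_power q (u \<bullet> v) * P v \<partial>\<sigma>) + (\<integral>v. abs_power q (u \<bullet> v) * P (T v) \<partial>\<sigma>) =
      2 * (\<integral>v. abs_power q (u \<bullet> v) * P v \<partial>\<sigma>)" by (simp add: even_u)
    moreover have "(\<integral>v. abs_power q (u \<bullet> v) * P v \<partial>\<sigma>) + (\<integral>v. abs_power q (u \<bullet> v) * P (T v) \<partial>\<sigma>) =
      (\<integral>v. abs_power q (u \<bullet> v) * P v + abs_power q (u \<bullet> v) * P (T v) \<partial>\<sigma>)"
      by (intro Bochner_Integration.integral_add[symmetric] integrable_abs_power[OF \<sigma> q] Pc PTc)
    moreover have "\<dots> = (\<integral>v. 2 * (abs_power q (u \<bullet> v) * g v) \<partial>\<sigma>)"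
      by (rule Bochner_Integration.integral_cong) (simp_all add: g_def algebra_simps)
    ultimately show ?thesis by simp
  qed
  define a where "a = (if even l then P u else 0)"
  \<comment> \<open>Since P (- u) = (-1)^l P u, the average over the two poles is P u for even l and
    0 for odd l.\<close>
  have ga: "g u = a" "g (- u) = a"
    using homogeneous_polynomial_uminus[OF P, of u] by (auto simp: g_def a_def T(3) Tu)
  define R where "R k = (\<integral>v. abs_power (p + 2 * real k) (u \<bullet> v) * P v \<partial>\<sigma>) / zonal_mass \<sigma> u (p + 2 * real k)" for k
  have "R \<longlonglongrightarrow> a"
    using zonal_average_tendsto[OF \<sigma> gc u p ga] sym p by (simp add: R_def[abs_def])
  then have R: "(\<lambda>k. R (Suc k)) \<longlonglongrightarrow> a" by (rule LIMSEQ_Suc)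
  have "(\<lambda>n. (\<Prod>k\<le>n. funk_hecke_factor CARD('n) l p k) * R (Suc n)) \<longlonglongrightarrow>
    prodinf (funk_hecke_factor CARD('n) l p) * a"
    by (intro tendsto_mult R convergent_prod_LIMSEQ convergent_prod_funk_hecke_factor p d)
  moreover have "(\<Prod>k\<le>n. funk_hecke_factor CARD('n) l p k) * R (Suc n) = R 0" for n
    using abs_power_integral_prod[OF \<sigma> P harm p u, of "Suc n"]
    unfolding R_def lessThan_Suc_atMost by simp
  ultimately have "R 0 = prodinf (funk_hecke_factor CARD('n) l p) * a"
    by (simp add: LIMSEQ_const_iff)
  then show ?thesis
    using zonal_mass_pos[OF \<sigma> p u] by (auto simp: R_def a_def field_simps)
qed

section \<open>The multipliers and the active spectrum\<close>

text \<open>The integral formula shows that a scalar exists, and a nonzero harmonic shows that it is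
  unique. As the mass is positive, only odd l or a vanishing product can make it 0.\<close>

lemma funk_hecke_multiplier_abs_power_eq_0_iff:
  assumes d: "CARD('n) \<ge> 2" and \<sigma>: "rotation_invariant_prob_on_sphere (\<sigma> :: (real ^ 'n) measure)"
    and p: "p \<ge> 0"
  shows "funk_hecke_multiplier \<sigma> l (abs_power p) = 0 \<longleftrightarrow> odd l \<or> (\<exists>k. p + 2 * real k + 2 = real l)"
proof -
  obtain Y0 and w :: "real ^ 'n" where Y0: "Y0 \<in> spherical_harmonics l" and w: "w \<in> sphere 0 1"
    and nz: "Y0 w \<noteq> 0"
    using ex_nonzero_spherical_harmonic[OF d] by metis
  define c where "c = (if even l then zonal_mass \<sigma> w p * prodinf (funk_hecke_factor CARD('n) l p) else 0)"
  have c: "(\<integral>v. abs_power p (u \<bullet> v) * Y v \<partial>\<sigma>) = c * Y u"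
    if Y: "Y \<in> spherical_harmonics l" and u: "u \<in> sphere 0 1" for Y u
  proof -
    obtain P where P: "Y = restrict P (sphere 0 1)" "homogeneous_polynomial l P" "\<And>x. laplacian P x = 0"
    proof -
      have "\<exists>P. Y = restrict P (sphere 0 1) \<and> homogeneous_polynomial l P \<and> (\<forall>x. laplacian P x = 0)"
        using Y unfolding spherical_harmonics_def by (rule CollectD)
      then show thesis using that by (elim exE conjE) simp
    qed
    have "(\<integral>v. abs_power p (u \<bullet> v) * Y v \<partial>\<sigma>) = (\<integral>v. abs_power p (u \<bullet> v) * P v \<partial>\<sigma>)"
      by (intro Bochner_Integration.integral_cong refl) (simp add: P(1) space_rotation_invariant[OF \<sigma>])
    also have "\<dots> = c * P u"
      unfolding funk_hecke_abs_power[OF d \<sigma> P(2,3) p u] c_def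
        zonal_mass_cong[OF d \<sigma> p u w] ..
    finally show ?thesis using u by (simp add: P(1))
  qed
  have "funk_hecke_multiplier \<sigma> l (abs_power p) = c"
    unfolding funk_hecke_multiplier_def
  proof (rule the_equality)
    fix b assume b: "\<forall>Y\<in>spherical_harmonics l. \<forall>u\<in>sphere 0 1. (\<integral>v. abs_power p (u \<bullet> v) * Y v \<partial>\<sigma>) = b * Y u"
    have "b * Y0 w = c * Y0 w"
      by (rule trans[OF sym[OF b[rule_format, OF Y0 w]] c[OF Y0 w]])
    then show "b = c" using nz by simp
  qed (use c in blast)
  moreover have "c = 0 \<longleftrightarrow> odd l \<or> (\<exists>k. p + 2 * real k + 2 = real l)"
    using zonal_mass_pos[OF \<sigma> p w] prodinf_funk_hecke_factor_eq_0_iff[OF p d, of l]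
    by (auto simp: c_def)
  ultimately show ?thesis by simp
qed

theorem corollary4p2:
  fixes \<sigma> :: "(real ^ 'n) measure" and p :: real
  assumes "CARD('n) \<ge> 2"
    and "rotation_invariant_prob_on_sphere \<sigma>"
    and "p \<ge> 0"
  shows "(\<forall>m::nat. m \<ge> 1 \<and> p = 2 * real m \<longrightarrow>
            active_spectrum \<sigma> (abs_power p) = {2 * k | k. 1 \<le> k \<and> k \<le> m}) \<and>
         (p > 0 \<and> \<not> (\<exists>k::int. p = 2 * real_of_int k) \<longrightarrow>
            active_spectrum \<sigma> (abs_power p) = {2 * k | k. k \<ge> 1}) \<and>
         (p = 0 \<longrightarrow> active_spectrum \<sigma> (abs_power p) = {})"
proof -
  have "active_spectrum \<sigma> (abs_power p) =
    {l. l \<ge> 1 \<and> even l \<and> \<not> (\<exists>k. p + 2 * real k + 2 = real l)}"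
    using funk_hecke_multiplier_abs_power_eq_0_iff[OF assms] by (auto simp: active_spectrum_def)
  also have "\<dots> = {2 * j | j. j \<ge> 1 \<and> \<not> (\<exists>k. p + 2 * real k + 2 = real (2 * j))}"
    by (auto elim!: evenE)
  finally have spec: "active_spectrum \<sigma> (abs_power p) =
    {2 * j | j. j \<ge> 1 \<and> \<not> (\<exists>k. p + 2 * real k + 2 = real (2 * j))}" .
  \<comment> \<open>For p = 2 m, degree 2 j is annihilated by the factor with k = j - m - 1, which
    is a natural number exactly if j > m.\<close>
  have even_case: "(\<exists>k. 2 * real m + 2 * real k + 2 = real (2 * j)) \<longleftrightarrow> j > m" for m j
  proof
    assume "j > m"
    then show "\<exists>k. 2 * real m + 2 * real k + 2 = real (2 * j)"
      by (intro exI[of _ "j - m - 1"]) (simp add: of_nat_diff)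
  qed auto
  show ?thesis
  proof (intro conjI allI impI)
    fix m :: nat assume "m \<ge> 1 \<and> p = 2 * real m"
    then show "active_spectrum \<sigma> (abs_power p) = {2 * k | k. 1 \<le> k \<and> k \<le> m}"
      unfolding spec using even_case[of m] by (auto simp: not_less)
  next
    assume p: "p > 0 \<and> \<not> (\<exists>k::int. p = 2 * real_of_int k)"
    have "p + 2 * real k + 2 \<noteq> real (2 * j)" for k j
    proof
      assume "p + 2 * real k + 2 = real (2 * j)"
      \<comment> \<open>A vanishing factor would make p an even integer; the subtraction is taken in
        \<open>int\<close> to avoid truncation.\<close>
      then have "p = 2 * real_of_int (int j - int k - 1)" by simp
      with p show False by blast
    qed
    then show "active_spectrum \<sigma> (abs_power p) = {2 * k | k. k \<ge> 1}"
      unfolding spec by simp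
  next
    \<comment> \<open>This is m = 0 in \<open>even_case\<close>: every j >= 1 is
      annihilated.\<close>
    assume "p = 0"
    then show "active_spectrum \<sigma> (abs_power p) = {}"
      unfolding spec using even_case[of 0] by auto
  qed
qed

end
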